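(* Let $\mathbb{K}$ be a field, $c\in\mathbb{N}$, $R=\mathbb{K}[x_{i,j}\mid 1\le i\le c,\ j\in\mathbb{N}]$, and let $J_\circ=J_1\subseteq J_2\subseteq\dots$ be an $\mathrm{Inc}(\mathbb{N})$-invariant ideal chain in $R$. Then the following statements are equivalent: (1) The set $\mathrm{I}(J_\circ)=\{\mathrm{Ind}(\mathrm{in}_\preceq(J_\circ))\mid\ \preceq\text{ an }\mathrm{Inc}(\mathbb{N})\text{-compatible term order on }R\}$ is bounded above. (2) The set of ideal chains $\{\mathrm{in}_\preceq(J_\circ)\mid\ \preceq\text{ is an }\mathrm{Inc}(\mathbb{N})\text{-compatible term order on }R\}$ is finite. Furthermore, these two statements imply: (3) There is $N\in\mathbb{N}$ such that $$\mathrm{in}_\preceq(J_n)=\sum_{1\le i_1<\dots<i_N\le n}\left\langle\mathrm{in}_\preceq(J_n\cap R_{\{i_1,\dots,i_N\}})\right\rangle_{R_n}$$ for all $n\ge N$ and every $\mathrm{Inc}(\mathbb{N})$-compatible term order $\preceq$ on $R$, where $J_n\cap R_{\{i_1,\dots,i_N\}}$ is regarded as an ideal of $R_{\{i_1,\dots,i_N\}}$. If $J_\circ$ is not only $\mathrm{Inc}(\mathbb{N})$-invariant but also $S_\infty$-invariant, then (3) is equivalent to (1) and (2).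
   Context: $\mathbb{N}=\{1,2,3,\dots\}$ and $[n]=\{1,\dots,n\}$. For $A\subseteq\mathbb{N}$, $R_A=\mathbb{K}[x_{i,j}\mid i\in[c],j\in A]\subseteq R$, and $R_n=R_{[n]}$. $\mathrm{Inc}(\mathbb{N})$ is the monoid of strictly increasing functions $p:\mathbb{N}\to\mathbb{N}$; it acts on $R$ by $\mathbb{K}$-linear extension of $p\cdot(x_{i_1,j_1}^{e_1}\cdots x_{i_r,j_r}^{e_r})=x_{i_1,p(j_1)}^{e_1}\cdots x_{i_r,p(j_r)}^{e_r}$. For $m\le n$, $\mathrm{Inc}(\mathbb{N})_{m,n}=\{p\in\mathrm{Inc}(\mathbb{N})\mid p(m)\le n\}$. For a set $P$ of maps and a set $F$ of polynomials, $P\cdot F=\{p\cdot f\mid p\in P,f\in F\}$, and $\langle F\rangle_{R_n}$ is the ideal of $R_n$ generated by $F$. $S_n$ is the group of bijections $\sigma:\mathbb{N}\to\mathbb{N}$ with $\sigma(i)=i$ for all $i\ge n+1$, and $S_\infty=\bigcup_n S_n$; it acts on $R$ by $\mathbb{K}$-linear extension of $\sigma\cdot(x_{i_1,j_1}^{e_1}\cdots x_{i_r,j_r}^{e_r})=x_{i_1,\sigma(j_1)}^{e_1}\cdots x_{i_r,\sigma(j_r)}^{e_r}$. An ideal chain $J_\circ=J_1\subseteq J_2\subseteq\dots$ (each $J_n$ an ideal of $R_n$) is $\mathrm{Inc}(\mathbb{N})$-invariant if $\mathrm{Inc}(\mathbb{N})_{m,n}\cdot J_m\subseteq J_n$ for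 all $m\le n$, and $S_\infty$-invariant if $S_n\cdot J_m\subseteq J_n$ for all $m\le n$. It is a known result (Hillar–Sullivant) that for every $\mathrm{Inc}(\mathbb{N})$-invariant ideal chain there is $N\in\mathbb{N}$ with $\langle\mathrm{Inc}(\mathbb{N})_{N,n}\cdot J_N\rangle_{R_n}=J_n$ for all $n\ge N$; the minimal such $N$ is the stability index $\mathrm{Ind}(J_\circ)$. A term order $\preceq$ on $R$ is a total order on the monomials of $R$ that respects multiplication and satisfies $1\preceq f$ for every monomial $f$. It is $\mathrm{Inc}(\mathbb{N})$-compatible if $f\preceq g$ implies $p\cdot f\preceq p\cdot g$ for all monomials $f,g\in R$ and all $p\in\mathrm{Inc}(\mathbb{N})$. $\mathrm{in}_\preceq(f)$ denotes the leading (i.e. $\preceq$-largest) monomial of a nonzero polynomial $f$; for an ideal $J$ of $R_A$, $\mathrm{in}_\preceq(J)$ is the ideal of $R_A$ generated by the leading monomials of the nonzero elements of $J$. For an $\mathrm{Inc}(\mathbb{N})$-compatible term order, $\mathrm{in}_\preceq(J_\circ):=\mathrm{in}_\preceq(J_1)\subseteq\mathrm{in}_\preceq(J_2)\subseteq\dots$ is again an $\mathrm{Inc}(\mathbb{N})$-invariant ideal chain. *)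

theory Defs
  imports "HOL-Library.Poly_Mapping" "HOL-Library.FuncSet" "HOL-Library.Set_Algebras"
    "HOL-Combinatorics.Permutations" "HOL-Algebra.Ideal"
begin

text \<open>
  The natural numbers of the source start at 1 and are written \<open>{1..}\<close>; arguments and
  indices 0 never matter.  The variable \<open>x\<^sub>i\<^sub>,\<^sub>j\<close> is the pair \<open>(i, j)\<close>.  A monomial is its
  exponent vector, so that the monomial 1 is \<open>0\<close> and the product of monomials is \<open>+\<close>.
\<close>

type_synonym mon = "(nat \<times> nat) \<Rightarrow>\<^sub>0 nat"
type_synonym 'k mpol = "mon \<Rightarrow>\<^sub>0 'k"

definition monomials :: "nat \<Rightarrow> nat set \<Rightarrow> mon set" where
  "monomials c A = {m. Poly_Mapping.keys m \<subseteq> {1..c} \<times> A}"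

text \<open>\<open>polyring c A\<close> is the polynomial ring \<open>R\<^sub>A\<close>; thus \<open>R\<close> is \<open>polyring c {1..}\<close> and
  \<open>R\<^sub>n\<close> is \<open>polyring c {1..n}\<close>.\<close>

definition polyring :: "nat \<Rightarrow> nat set \<Rightarrow> ('k::field mpol) ring" where
  "polyring c A = \<lparr>carrier = {f. Poly_Mapping.keys f \<subseteq> monomials c A},
     monoid.mult = (*), one = 1, zero = 0, add = (+)\<rparr>"

lemma cring_polyring: "cring (polyring c A :: ('k::field mpol) ring)"
proof (rule cringI)
  have add: "f + g \<in> carrier (polyring c A)"
    if "f \<in> carrier (polyring c A)" "g \<in> carrier (polyring c A)" for f g :: "'k mpol"
    using that keys_add[of f g] by (auto simp: polyring_def)
  have mult: "f * g \<in> carrier (polyring c A)"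
    if "f \<in> carrier (polyring c A)" "g \<in> carrier (polyring c A)" for f g :: "'k mpol"
  proof -
    have "a + b \<in> monomials c A" if "a \<in> monomials c A" "b \<in> monomials c A" for a b
      using that keys_add[of a b] by (auto simp: monomials_def)
    with that keys_mult[of f g] show ?thesis by (fastforce simp: polyring_def)
  qed
  show "abelian_group (polyring c A :: ('k mpol) ring)"
  proof (rule abelian_groupI)
    fix f :: "'k mpol" assume "f \<in> carrier (polyring c A)"
    then show "\<exists>g\<in>carrier (polyring c A). g \<oplus>\<^bsub>polyring c A\<^esub> f = \<zero>\<^bsub>polyring c A\<^esub>"
      by (intro bexI[of _ "- f"]) (auto simp: polyring_def)
  qed (use add in \<open>auto simp: polyring_def algebra_simps\<close>)
  show "comm_monoid (polyring c A :: ('k mpol) ring)"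
    by (rule comm_monoidI) (use mult in \<open>auto simp: polyring_def monomials_def algebra_simps\<close>)
qed (auto simp: polyring_def algebra_simps)

text \<open>Action of a map \<open>p\<close> of the second variable index on monomials and polynomials.\<close>

definition act_mon :: "(nat \<Rightarrow> nat) \<Rightarrow> mon \<Rightarrow> mon" where
  "act_mon p m = (\<Sum>(i, j)\<in>Poly_Mapping.keys m. Poly_Mapping.single (i, p j) (Poly_Mapping.lookup m (i, j)))"

definition act :: "(nat \<Rightarrow> nat) \<Rightarrow> 'k::field mpol \<Rightarrow> 'k mpol" where
  "act p f = (\<Sum>m\<in>Poly_Mapping.keys f. Poly_Mapping.single (act_mon p m) (Poly_Mapping.lookup f m))"

definition act_set :: "(nat \<Rightarrow> nat) set \<Rightarrow> ('k::field mpol) set \<Rightarrow> ('k mpol) set" where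
  "act_set P F = {act p f |p f. p \<in> P \<and> f \<in> F}"

definition Inc :: "(nat \<Rightarrow> nat) set" where
  "Inc = {p. p \<in> {1..} \<rightarrow> {1..} \<and> strict_mono_on {1..} p}"

definition Inc_mn :: "nat \<Rightarrow> nat \<Rightarrow> (nat \<Rightarrow> nat) set" where
  "Inc_mn m n = {p \<in> Inc. p m \<le> n}"

definition ideal_chain :: "nat \<Rightarrow> (nat \<Rightarrow> ('k::field mpol) set) \<Rightarrow> bool" where
  "ideal_chain c J \<longleftrightarrow> (\<forall>n\<ge>1. ideal (J n) (polyring c {1..n})) \<and>
     (\<forall>m n. 1 \<le> m \<and> m \<le> n \<longrightarrow> J m \<subseteq> J n)"

definition Inc_invariant_chain :: "nat \<Rightarrow> (nat \<Rightarrow> ('k::field mpol) set) \<Rightarrow> bool" where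
  "Inc_invariant_chain c J \<longleftrightarrow> ideal_chain c J \<and>
     (\<forall>m n. 1 \<le> m \<and> m \<le> n \<longrightarrow> act_set (Inc_mn m n) (J m) \<subseteq> J n)"

definition Sym_invariant_chain :: "nat \<Rightarrow> (nat \<Rightarrow> ('k::field mpol) set) \<Rightarrow> bool" where
  "Sym_invariant_chain c J \<longleftrightarrow> ideal_chain c J \<and>
     (\<forall>m n. 1 \<le> m \<and> m \<le> n \<longrightarrow> act_set {\<sigma>. \<sigma> permutes {1..n}} (J m) \<subseteq> J n)"

text \<open>The minimum exists for every \<open>Inc\<close>-invariant chain (Hillar and Sullivant).\<close>

definition Ind :: "nat \<Rightarrow> (nat \<Rightarrow> ('k::field mpol) set) \<Rightarrow> nat" where
  "Ind c J = (LEAST N. N \<ge> 1 \<and>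
     (\<forall>n\<ge>N. Idl\<^bsub>polyring c {1..n}\<^esub> (act_set (Inc_mn N n) (J N)) = J n))"

text \<open>A term order is a relation on the monomials of \<open>R\<close>, where \<open>(f, g) \<in> r\<close> means \<open>f \<preceq> g\<close>.\<close>

definition term_order :: "nat \<Rightarrow> mon rel \<Rightarrow> bool" where
  "term_order c r \<longleftrightarrow> linear_order_on (monomials c {1..}) r \<and>
     (\<forall>f g. \<forall>h \<in> monomials c {1..}. (f, g) \<in> r \<longrightarrow> (f + h, g + h) \<in> r) \<and>
     (\<forall>f \<in> monomials c {1..}. (0, f) \<in> r)"

definition Inc_compatible_order :: "nat \<Rightarrow> mon rel \<Rightarrow> bool" where
  "Inc_compatible_order c r \<longleftrightarrow> term_order c r \<and>
     (\<forall>p \<in> Inc. \<forall>f g. (f, g) \<in> r \<longrightarrow> (act_mon p f, act_mon p g) \<in> r)"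

text \<open>Only meaningful for nonzero polynomials.\<close>

definition lead_mon :: "mon rel \<Rightarrow> 'k::field mpol \<Rightarrow> mon" where
  "lead_mon r f = (THE m. m \<in> Poly_Mapping.keys f \<and> (\<forall>m' \<in> Poly_Mapping.keys f. (m', m) \<in> r))"

definition init_ideal ::
    "nat \<Rightarrow> mon rel \<Rightarrow> nat set \<Rightarrow> ('k::field mpol) set \<Rightarrow> ('k mpol) set" where
  "init_ideal c r A J =
     Idl\<^bsub>polyring c A\<^esub> {Poly_Mapping.single (lead_mon r f) 1 |f. f \<in> J \<and> f \<noteq> 0}"

text \<open>The restriction removes the meaningless entry at index 0, so that two chains are equal
  as functions iff they have the same ideals at all indices \<open>n \<ge> 1\<close>.\<close>

definition init_chain ::
    "nat \<Rightarrow> mon rel \<Rightarrow> (nat \<Rightarrow> ('k::field mpol) set) \<Rightarrow> nat \<Rightarrow> ('k mpol) set" where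
  "init_chain c r J = (\<lambda>n\<in>{1..}. init_ideal c r {1..n} (J n))"

text \<open>A sequence \<open>i\<^sub>1 < \<dots> < i\<^sub>N \<le> n\<close> is the set \<open>I\<close> of its entries; the sum is the
  elementwise sum of sets.\<close>

definition init_local ::
    "nat \<Rightarrow> (nat \<Rightarrow> ('k::field mpol) set) \<Rightarrow> bool" where
  "init_local c J \<longleftrightarrow> (\<exists>N\<ge>1. \<forall>n\<ge>N. \<forall>r. Inc_compatible_order c r \<longrightarrow>
     init_ideal c r {1..n} (J n) =
       (\<Sum>I | I \<subseteq> {1..n} \<and> card I = N.
          Idl\<^bsub>polyring c {1..n}\<^esub> (init_ideal c r I (J n \<inter> carrier (polyring c I)))))"

end

theory Submission
  imports Defs "HOL.Topological_Spaces" "HOL-Library.Sublist" "HOL-Library.Infinite_Set"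
begin

text \<open>
  The initial ideal of \<open>J\<^sub>n\<close> is spanned by the leading monomials of \<open>J\<^sub>n\<close>, so everything is
  expressed through sets of monomials closed under multiples.  Reading a monomial of \<open>R\<^sub>n\<close> as a word
  of length \<open>n\<close> over \<open>\<nat>\<^sup>c\<close>, divisibility up to an increasing map is Higman's embedding
  order; its well-quasi-orderedness gives the stability index of an initial chain.

  If the stability indices are bounded by \<open>N\<close>, an initial chain is determined by its first
  \<open>N\<close> members, and each \<open>J\<^sub>n\<close> has only finitely many initial ideals; moreover a leading monomial of
  \<open>J\<^sub>n\<close> is a multiple of the leading monomial of some \<open>p \<cdot> f\<close> with \<open>f \<in> J\<^sub>N\<close>, a polynomial in at most
  \<open>N\<close> columns.  Conversely, in the symmetric case \<open>J\<^sub>n \<inter> R\<^sub>N\<close> becomes stationary at some \<open>M\<close>, and a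
  polynomial of \<open>J\<^sub>n\<close> in \<open>N\<close> columns is \<open>q \<cdot> g\<close> with \<open>g \<in> J\<^sub>M\<close> and \<open>q\<close> increasing, so \<open>M\<close> bounds all
  stability indices.
\<close>

subsection \<open>Well-quasi-orders and increasing maps\<close>

text \<open>Any sequence has a monotone subsequence. If that one descends, it is constant from the
  point on where it attains its least value, and a constant sequence is ascending.\<close>

lemma nat_seq_mono_subseq:
  fixes s :: "nat \<Rightarrow> nat"
  shows "\<exists>\<phi> :: nat \<Rightarrow> nat. strict_mono \<phi> \<and> mono (s \<circ> \<phi>)"
proof -
  obtain \<psi> :: "nat \<Rightarrow> nat" where \<psi>: "strict_mono \<psi>" "monoseq (\<lambda>n. s (\<psi> n))"
    using seq_monosub[of s] by auto
  show ?thesis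
  proof (cases "\<forall>m n. m \<le> n \<longrightarrow> s (\<psi> m) \<le> s (\<psi> n)")
    case True
    then show ?thesis using \<psi>(1) by (auto simp: mono_def)
  next
    case False
    then have dec: "\<forall>m n. m \<le> n \<longrightarrow> s (\<psi> n) \<le> s (\<psi> m)"
      using \<psi>(2) unfolding monoseq_def by blast
    obtain k where k: "\<And>n. s (\<psi> k) \<le> s (\<psi> n)"
      using ex_has_least_nat[of "\<lambda>_. True" 0 "\<lambda>n. s (\<psi> n)"] by auto
    have "s (\<psi> (k + n)) = s (\<psi> k)" for n
      using dec k[of "k + n"] by (simp add: le_antisym)
    moreover have "strict_mono (\<lambda>n. \<psi> (k + n))"
      using \<psi>(1) by (auto simp: strict_mono_def)
    ultimately show ?thesis
      by (intro exI[of _ "\<lambda>n. \<psi> (k + n)"]) (auto simp: mono_def)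
  qed
qed

text \<open>Dickson's lemma in subsequence form: the sequence is thinned out once for each
  coordinate in \<open>S\<close>, and thinning preserves what was achieved for the earlier
  coordinates.\<close>

lemma dickson_subseq:
  fixes w :: "nat \<Rightarrow> 's \<Rightarrow> nat"
  assumes "finite S"
  shows "\<exists>\<phi> :: nat \<Rightarrow> nat. strict_mono \<phi> \<and> (\<forall>i j. i \<le> j \<longrightarrow> (\<forall>s\<in>S. w (\<phi> i) s \<le> w (\<phi> j) s))"
  using assms
proof (induction S)
  case empty
  show ?case by (intro exI[of _ id]) (simp add: strict_mono_def)
next
  case (insert x S)
  then obtain \<phi> :: "nat \<Rightarrow> nat" where \<phi>: "strict_mono \<phi>" "\<forall>i j. i \<le> j \<longrightarrow> (\<forall>s\<in>S. w (\<phi> i) s \<le> w (\<phi> j) s)"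
    by auto
  obtain \<psi> :: "nat \<Rightarrow> nat" where \<psi>: "strict_mono \<psi>" "mono ((\<lambda>n. w (\<phi> n) x) \<circ> \<psi>)"
    using nat_seq_mono_subseq by blast
  show ?case
  proof (intro exI[of _ "\<phi> \<circ> \<psi>"] conjI allI impI ballI)
    show "strict_mono (\<phi> \<circ> \<psi>)"
      using \<phi>(1) \<psi>(1) by (simp add: strict_mono_o)
    fix i j :: nat and s assume "i \<le> j" "s \<in> insert x S"
    then show "w ((\<phi> \<circ> \<psi>) i) s \<le> w ((\<phi> \<circ> \<psi>) j) s"
      using \<phi>(2) \<psi>(2) strict_mono_less_eq[OF \<psi>(1)] by (auto simp: mono_def)
  qed
qed

text \<open>Nash-Williams' minimal bad sequence argument. The hypothesis states that
  \<open>P\<close> is a well-quasi-order in the form that every sequence has a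
  \<open>P\<close>-ascending subsequence.\<close>

theorem higman:
  fixes P :: "'a \<Rightarrow> 'a \<Rightarrow> bool" and w :: "nat \<Rightarrow> 'a list"
  assumes wqo: "\<And>s. \<exists>\<phi>::nat \<Rightarrow> nat. strict_mono \<phi> \<and> (\<forall>i j. i < j \<longrightarrow> P (s (\<phi> i)) (s (\<phi> j)))"
  shows "\<exists>i j. i < j \<and> list_emb P (w i) (w j)"
proof (rule ccontr)
  define bad where "bad = (\<lambda>h :: nat \<Rightarrow> 'a list. \<forall>i j. i < j \<longrightarrow> \<not> list_emb P (h i) (h j))"
  \<comment> \<open>\<open>least n g\<close>: among the bad sequences that share the first
    \<open>n\<close> words of \<open>g\<close>, none has a shorter word at position
    \<open>n\<close>.\<close>
  define least where "least = (\<lambda>n g. bad g \<and>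
    (\<forall>h. bad h \<and> (\<forall>k<n. h k = g k) \<longrightarrow> length (g n) \<le> length (h n)))"
  assume "\<not> ?thesis"
  then have "bad w" by (simp add: bad_def)
  have ex_least: "\<exists>h. least n h \<and> (\<forall>k<n. h k = g k)" if g: "bad g" for n :: nat and g
  proof -
    obtain h where "bad h \<and> (\<forall>k<n. h k = g k)"
      "\<And>h'. bad h' \<and> (\<forall>k<n. h' k = g k) \<Longrightarrow> length (h n) \<le> length (h' n)"
      using ex_has_least_nat[of "\<lambda>h. bad h \<and> (\<forall>k<n. h k = g k)" g "\<lambda>h. length (h n)"] g
      by blast
    then show ?thesis unfolding least_def by (intro exI[of _ h]) auto
  qed
  \<comment> \<open>Minimise the word lengths position by position. Later choices keep the words
    already fixed, so the diagonal \<open>g\<close> below is a bad sequence that is minimal at every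
    position.\<close>
  have "\<exists>H. \<forall>n. least n (H n) \<and> (\<forall>k<Suc n. H (Suc n) k = H n k)"
  proof (rule dependent_nat_choice)
    show "\<exists>g. least 0 g" using ex_least[OF \<open>bad w\<close>, of 0] by blast
    show "\<exists>h. least (Suc n) h \<and> (\<forall>k<Suc n. h k = g k)" if "least n g" for g n
      using that ex_least by (simp add: least_def)
  qed
  then obtain H where H: "\<And>n. least n (H n)" "\<And>n k. k \<le> n \<Longrightarrow> H (Suc n) k = H n k"
    by (auto simp: less_Suc_eq_le)
  define g where "g = (\<lambda>n. H n n)"
  have Hg: "H n k = g k" if "k \<le> n" for n k
    using that by (induction n rule: dec_induct) (auto simp: g_def H(2))
  have bad_g: "bad g"
    unfolding bad_def
  proof (intro allI impI)
    fix i j :: nat assume "i < j"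
    have "bad (H j)" using H(1) least_def by blast
    then show "\<not> list_emb P (g i) (g j)"
      using \<open>i < j\<close> Hg[of i j] Hg[of j j] unfolding bad_def by (metis less_imp_le order_refl)
  qed
  have least_g: "length (g n) \<le> length (h n)" if "bad h" "\<forall>k<n. h k = g k" for h n
    using H(1)[of n] that Hg[of _ n] by (auto simp: least_def)
  have ne: "g n \<noteq> []" for n
    using bad_g unfolding bad_def by (metis lessI list_emb_Nil)
  obtain \<phi> :: "nat \<Rightarrow> nat" where \<phi>: "strict_mono \<phi>"
    "\<And>i j. i < j \<Longrightarrow> P (hd (g (\<phi> i))) (hd (g (\<phi> j)))"
    using wqo[of "\<lambda>n. hd (g n)"] by blast
  \<comment> \<open>From position \<open>\<phi> 0\<close> on, \<open>g\<close> is replaced by the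
    tails of the words whose heads ascend. The word at \<open>\<phi> 0\<close> becomes shorter, so
    \<open>h\<close> cannot be bad.\<close>
  define h where "h = (\<lambda>k. if k < \<phi> 0 then g k else tl (g (\<phi> (k - \<phi> 0))))"
  have "\<not> bad h"
  proof
    assume "bad h"
    then have "length (g (\<phi> 0)) \<le> length (h (\<phi> 0))"
      by (intro least_g) (auto simp: h_def)
    then show False using ne[of "\<phi> 0"] by (cases "g (\<phi> 0)") (auto simp: h_def)
  qed
  then obtain i j where ij: "i < j" "list_emb P (h i) (h j)" by (auto simp: bad_def)
  have le: "\<phi> 0 \<le> \<phi> k" for k using \<phi>(1) by (simp add: strict_mono_less_eq)
  have g_eq: "g k = hd (g k) # tl (g k)" for k using ne by simp
  \<comment> \<open>Each good pair of \<open>h\<close> yields one of \<open>g\<close>: both words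
    are unchanged, or a word embeds into a tail and hence into the full word, or two tails embed and
    their heads, being related by \<open>P\<close>, can be put back.\<close>
  consider "j < \<phi> 0" | "i < \<phi> 0" "\<phi> 0 \<le> j" | "\<phi> 0 \<le> i" by linarith
  then show False
  proof cases
    case 1
    then show False using ij bad_g by (simp add: h_def bad_def)
  next
    case 2
    then have "list_emb P (g i) (g (\<phi> (j - \<phi> 0)))"
      using ij(2) g_eq[of "\<phi> (j - \<phi> 0)"] by (metis h_def list_emb_Cons not_less)
    then show False using bad_g 2 le[of "j - \<phi> 0"] by (auto simp: bad_def)
  next
    case 3
    define a b where "a = i - \<phi> 0" and "b = j - \<phi> 0"
    have "a < b" using 3 ij(1) by (auto simp: a_def b_def)
    have "list_emb P (tl (g (\<phi> a))) (tl (g (\<phi> b)))"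
      using 3 ij by (simp add: h_def a_def b_def)
    then have "list_emb P (hd (g (\<phi> a)) # tl (g (\<phi> a))) (hd (g (\<phi> b)) # tl (g (\<phi> b)))"
      using \<phi>(2)[OF \<open>a < b\<close>] by (rule list_emb_Cons2[rotated])
    then have "list_emb P (g (\<phi> a)) (g (\<phi> b))" using g_eq by simp
    then show False
      using bad_g strict_mono_less[OF \<phi>(1), of a b] \<open>a < b\<close> by (auto simp: bad_def)
  qed
qed

section \<open>Increasing maps and permutations with prescribed values\<close>

lemma list_emb_index_map:
  assumes "list_emb P xs ys"
  shows "\<exists>f. strict_mono_on {..<length xs} f \<and>
           (\<forall>k<length xs. f k < length ys \<and> P (xs ! k) (ys ! f k))"
  using assms
proof induction
  case (list_emb_Nil ys)
  show ?case by auto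
next
  case (list_emb_Cons xs ys y)
  then obtain f where f: "strict_mono_on {..<length xs} f"
    "\<forall>k<length xs. f k < length ys \<and> P (xs ! k) (ys ! f k)" by blast
  then show ?case
    by (intro exI[of _ "Suc \<circ> f"]) (auto simp: strict_mono_on_def)
next
  case (list_emb_Cons2 x y xs ys)
  then obtain f where f: "strict_mono_on {..<length xs} f"
    "\<forall>k<length xs. f k < length ys \<and> P (xs ! k) (ys ! f k)" by blast
  show ?case
    using f list_emb_Cons2.hyps
    by (intro exI[of _ "case_nat 0 (Suc \<circ> f)"])
       (auto simp: strict_mono_on_def nth_Cons split: nat.splits)
qed

text \<open>The complements of \<open>A\<close> and of its image in \<open>S\<close> have the same
  cardinality, so a bijection between them completes \<open>f\<close>.\<close>

lemma permutes_extending_inj_on: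
  assumes "finite S" "A \<subseteq> S" "inj_on f A" "f ` A \<subseteq> S"
  shows "\<exists>\<sigma>. \<sigma> permutes S \<and> (\<forall>a\<in>A. \<sigma> a = f a)"
proof -
  let ?B = "f ` A"
  have bij: "bij_betw f A ?B" using assms(3) by (rule inj_on_imp_bij_betw)
  have "card (S - A) = card (S - ?B)"
    using assms by (simp add: card_image card_Diff_subset finite_subset)
  then obtain g where g: "bij_betw g (S - A) (S - ?B)"
    using assms(1) finite_same_card_bij by blast
  define \<sigma> where "\<sigma> = (\<lambda>x. if x \<in> A then f x else if x \<in> S then g x else x)"
  have "bij_betw \<sigma> (A \<union> (S - A)) (?B \<union> (S - ?B))"
  proof (rule bij_betw_combine)
    show "bij_betw \<sigma> A ?B" using bij by (rule bij_betw_cong[THEN iffD1, rotated]) (simp add: \<sigma>_def)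
    show "bij_betw \<sigma> (S - A) (S - ?B)" using g by (rule bij_betw_cong[THEN iffD1, rotated]) (simp add: \<sigma>_def)
  qed auto
  moreover have "A \<union> (S - A) = S" "?B \<union> (S - ?B) = S" using assms by auto
  ultimately have "\<sigma> permutes S"
    using assms(2) by (intro bij_imp_permutes) (auto simp: \<sigma>_def)
  then show ?thesis by (intro exI[of _ \<sigma>]) (simp add: \<sigma>_def)
qed

text \<open>The map enumerates \<open>I\<close> together with all numbers above \<open>n\<close>;
  the added tail makes the set infinite, so that the map is defined on all positive numbers. The
  shift by one is due to \<open>enumerate\<close> counting from 0.\<close>

lemma Inc_enumerating:
  assumes "I \<subseteq> {1..n}" "card I = M" "M \<ge> 1"
  shows "\<exists>q\<in>Inc_mn M n. q ` {1..M} = I"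
proof -
  define S where "S = I \<union> {n<..}"
  have "infinite S" by (simp add: S_def infinite_Ioi)
  define q where "q = (\<lambda>j. enumerate S (j - 1))"
  have S1: "S \<subseteq> {1..}" using assms(1) by (auto simp: S_def)
  have mono: "strict_mono_on {1..} q"
    by (auto simp: strict_mono_on_def q_def \<open>infinite S\<close> intro!: enumerate_mono)
  have qS: "q j \<in> S" for j by (simp add: q_def enumerate_in_set \<open>infinite S\<close>)
  have im: "q ` {1..} = S"
  proof -
    have "q ` {1..} = enumerate S ` ((\<lambda>j. j - 1) ` {1..})" by (simp add: q_def image_image)
    also have "(\<lambda>j. j - 1) ` {1..} = (UNIV :: nat set)"
    proof -
      have "x \<in> (\<lambda>j. j - 1) ` {1..}" for x :: nat by (rule image_eqI[of _ _ "Suc x"]) auto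
      then show ?thesis by auto
    qed
    also have "enumerate S ` UNIV = S" using range_enumerate[OF \<open>infinite S\<close>] .
    finally show ?thesis .
  qed
  have finI: "finite I" using assms(1) finite_subset by blast
  have "q M \<le> n"
  proof (rule ccontr)
    assume "\<not> q M \<le> n"
    \<comment> \<open>If the value at \<open>M\<close> exceeded \<open>n\<close>, all of
      \<open>I\<close> would have been listed earlier, leaving room for at most \<open>M - 1\<close>
      elements.\<close>
    have "I \<subseteq> q ` {1..<M}"
    proof
      fix x assume "x \<in> I"
      then obtain j where j: "j \<ge> 1" "x = q j" using im by (auto simp: S_def)
      have "q j < q M" using \<open>x \<in> I\<close> j assms(1) \<open>\<not> q M \<le> n\<close> by auto
      then have "j < M" using mono j(1) assms(3)
        by (meson atLeast_iff not_le_imp_less order_less_imp_le strict_mono_on_leD leD)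
      then show "x \<in> q ` {1..<M}" using j by auto
    qed
    then have "card I \<le> card {1..<M}" by (meson card_image_le card_mono finite_atLeastLessThan finite_imageI le_trans)
    then show False using assms(2,3) by simp
  qed
  then have sub: "q ` {1..M} \<subseteq> I"
  proof (intro image_subsetI)
    fix j assume "j \<in> {1..M}"
    then have "q j \<le> q M" using mono by (auto intro: strict_mono_on_leD)
    then show "q j \<in> I" using qS[of j] \<open>q M \<le> n\<close> by (auto simp: S_def)
  qed
  have "inj_on q {1..M}"
    using mono strict_mono_on_imp_inj_on by (metis atLeastAtMost_iff atLeast_iff inj_on_subset subsetI)
  then have "q ` {1..M} = I"
    using sub finI assms(2) by (simp add: card_image card_subset_eq)
  moreover have "q \<in> Inc_mn M n"
    using mono S1 qS \<open>q M \<le> n\<close> by (auto simp: Inc_mn_def Inc_def)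
  ultimately show ?thesis by blast
qed

lemma IncD:
  assumes "p \<in> Inc"
  shows "inj_on p {1..}" "p ` {1..} \<subseteq> {1..}" "strict_mono_on {1..} p"
  using assms strict_mono_on_imp_inj_on by (auto simp: Inc_def)

lemma Inc_mn_image:
  assumes "p \<in> Inc_mn m n"
  shows "p ` {1..m} \<subseteq> {1..n}"
proof
  fix x assume "x \<in> p ` {1..m}"
  then obtain j where j: "1 \<le> j" "j \<le> m" "x = p j" by auto
  have "p \<in> Inc" "p m \<le> n" using assms by (auto simp: Inc_mn_def)
  then have "p j \<le> p m" "p j \<ge> 1"
    using j strict_mono_on_leD[OF IncD(3), of p j m] by (auto simp: Inc_def)
  then show "x \<in> {1..n}" using j \<open>p m \<le> n\<close> by auto
qed

text \<open>Elements of \<open>Inc\<close> act on all positive numbers. The values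
  \<open>n + j\<close> exceed everything prescribed on \<open>{1..m}\<close>, so this extension
  stays strictly increasing.\<close>

lemma Inc_mn_extend:
  assumes "strict_mono_on {1..m} f" "f ` {1..m} \<subseteq> {1..n}" "m \<ge> 1"
  shows "(\<lambda>j. if j \<le> m then f j else n + j) \<in> Inc_mn m n"
proof -
  have *: "f j \<ge> 1 \<and> f j \<le> n" if "1 \<le> j" "j \<le> m" for j using assms(2) that by (meson atLeastAtMost_iff image_subset_iff)
  have "f j < n + k" if "1 \<le> j" "j \<le> m" "j < k" for j k using *[OF that(1,2)] that by linarith
  then show ?thesis
    using assms(1,3) * by (auto simp: Inc_mn_def Inc_def strict_mono_on_def)
qed

text \<open>Enlarge the image of \<open>{1..m}\<close> to a \<open>k\<close>-element subset of
  \<open>{1..n}\<close>. Then \<open>q\<close> enumerates this subset and \<open>p'\<close> gives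
  the position of \<open>p j\<close> in it.\<close>

lemma Inc_mn_factor:
  assumes p: "p \<in> Inc_mn m n" and "1 \<le> m" "m \<le> k" "k \<le> n"
  shows "\<exists>q\<in>Inc_mn k n. \<exists>p'\<in>Inc_mn m k. \<forall>j\<in>{1..m}. p j = q (p' j)"
proof -
  have inj: "inj_on p {1..m}" and pI: "p \<in> Inc"
    using p IncD(1) inj_on_subset[of p "{1..}"] by (auto simp: Inc_mn_def)
  obtain I where I: "p ` {1..m} \<subseteq> I" "I \<subseteq> {1..n}" "card I = k"
    using exists_subset_between[of "p ` {1..m}" k "{1..n}"] Inc_mn_image[OF p] assms(3,4)
    by (auto simp: card_image[OF inj] simp del: One_nat_def)
  then obtain q where q: "q \<in> Inc_mn k n" "q ` {1..k} = I"
    using Inc_enumerating[of I n k] assms by auto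
  have qm: "strict_mono_on {1..k} q"
    using q(1) IncD(3)[of q] by (auto simp: Inc_mn_def strict_mono_on_def)
  have "\<forall>j\<in>{1..m}. \<exists>i\<in>{1..k}. p j = q i" using I(1) q(2) by blast
  then obtain f where f: "\<And>j. j \<in> {1..m} \<Longrightarrow> f j \<in> {1..k} \<and> p j = q (f j)" by metis
  have "strict_mono_on {1..m} f"
  proof (rule strict_mono_onI)
    fix a b assume ab: "a \<in> {1..m}" "b \<in> {1..m}" "a < b"
    then have "p a < p b"
      using IncD(3)[OF pI] by (auto simp: strict_mono_on_def)
    then have "q (f a) < q (f b)" using f[OF ab(1)] f[OF ab(2)] by simp
    then show "f a < f b"
      using strict_mono_on_leD[OF qm, of "f b" "f a"] f[OF ab(1)] f[OF ab(2)] by fastforce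
  qed
  moreover have "f ` {1..m} \<subseteq> {1..k}" using f by blast
  ultimately have "(\<lambda>j. if j \<le> m then f j else k + j) \<in> Inc_mn m k"
    using \<open>1 \<le> m\<close> by (rule Inc_mn_extend)
  then show ?thesis
    by (intro bexI[OF _ q(1)] bexI[of _ "\<lambda>j. if j \<le> m then f j else k + j"]) (simp_all add: f)
qed

subsection \<open>The action on monomials and polynomials\<close>

lemma zero_in_monomials [simp]: "0 \<in> monomials c A"
  by (simp add: monomials_def)

lemma monomials_add: "a \<in> monomials c A \<Longrightarrow> b \<in> monomials c A \<Longrightarrow> a + b \<in> monomials c A"
  using keys_add[of a b] by (auto simp: monomials_def)

lemma monomials_mono: "A \<subseteq> B \<Longrightarrow> monomials c A \<subseteq> monomials c B"
  by (auto simp: monomials_def)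

lemma keys_plus_nat:
  fixes a b :: "'a \<Rightarrow>\<^sub>0 nat"
  shows "Poly_Mapping.keys (a + b) = Poly_Mapping.keys a \<union> Poly_Mapping.keys b"
  by (auto simp: in_keys_iff lookup_add)

lemma monomials_addD:
  assumes "a + b \<in> monomials c A"
  shows "a \<in> monomials c A" "b \<in> monomials c A"
  using assms by (auto simp: monomials_def keys_plus_nat)

lemma act_mon_superset:
  assumes "finite X" "Poly_Mapping.keys m \<subseteq> X"
  shows "act_mon p m =
    (\<Sum>(i, j)\<in>X. Poly_Mapping.single (i, p j) (Poly_Mapping.lookup m (i, j)))"
  unfolding act_mon_def using assms
  by (intro sum.mono_neutral_left) (auto simp: in_keys_iff)

lemma act_mon_zero [simp]: "act_mon p 0 = 0"
  by (simp add: act_mon_def)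

lemma act_mon_add: "act_mon p (a + b) = act_mon p a + act_mon p b"
proof -
  let ?X = "Poly_Mapping.keys a \<union> Poly_Mapping.keys b"
  have "Poly_Mapping.keys (a + b) \<subseteq> ?X" using keys_add[of a b] by auto
  then show ?thesis
    by (simp add: act_mon_superset[of ?X] lookup_add single_add case_prod_unfold sum.distrib)
qed

lemma act_mon_single [simp]: "act_mon p (Poly_Mapping.single (i, j) k) = Poly_Mapping.single (i, p j) k"
  by (subst act_mon_superset[of "{(i, j)}"]) auto

lemma act_mon_sum: "act_mon p (sum g X) = (\<Sum>x\<in>X. act_mon p (g x))"
  by (induction X rule: infinite_finite_induct) (auto simp: act_mon_add)

lemma act_mon_comp: "act_mon p (act_mon q m) = act_mon (p \<circ> q) m"
  by (simp add: act_mon_def[of q m] act_mon_def[of "p \<circ> q" m] act_mon_sum case_prod_unfold)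

lemma act_mon_cong:
  assumes "m \<in> monomials c A" "\<And>j. j \<in> A \<Longrightarrow> p j = q j"
  shows "act_mon p m = act_mon q m"
  unfolding act_mon_def using assms by (intro sum.cong) (auto simp: monomials_def)

lemma poly_mapping_sum_singles:
  fixes f :: "'a \<Rightarrow>\<^sub>0 'b::comm_monoid_add"
  assumes "finite X" "Poly_Mapping.keys f \<subseteq> X"
  shows "f = (\<Sum>m\<in>X. Poly_Mapping.single m (Poly_Mapping.lookup f m))"
  using assms
  by (intro poly_mapping_eqI)
     (auto simp: lookup_sum lookup_single when_def in_keys_iff intro!: sum.neutral)

lemma act_mon_id: "act_mon id m = m"
  using poly_mapping_sum_singles[of "Poly_Mapping.keys m" m] by (simp add: act_mon_def case_prod_unfold)

lemma act_mon_image: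
  assumes "m \<in> monomials c A"
  shows "act_mon p m \<in> monomials c (p ` A)"
proof -
  have "sum g X \<in> monomials c B" if "\<And>x. x \<in> X \<Longrightarrow> g x \<in> monomials c B" for g X B
    using that by (induction X rule: infinite_finite_induct) (auto intro: monomials_add)
  moreover have "Poly_Mapping.single (i, p j) k \<in> monomials c (p ` A)"
    if "(i, j) \<in> Poly_Mapping.keys m" for i j k
    using that assms by (auto simp: monomials_def)
  ultimately show ?thesis unfolding act_mon_def case_prod_unfold
    by (metis (no_types, lifting) prod.collapse)
qed

text \<open>Injectivity on \<open>A\<close> keeps columns from being merged, so a single summand
  contributes to this exponent.\<close>

lemma lookup_act_mon:
  assumes "m \<in> monomials c A" "inj_on p A" "j \<in> A"
  shows "Poly_Mapping.lookup (act_mon p m) (i, p j) = Poly_Mapping.lookup m (i, j)"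
proof -
  have "(case x of (i', j') \<Rightarrow> Poly_Mapping.lookup (Poly_Mapping.single (i', p j') (Poly_Mapping.lookup m (i', j'))) (i, p j)) =
    (if x = (i, j) then Poly_Mapping.lookup m (i, j) else 0)" if "x \<in> Poly_Mapping.keys m" for x
    using that assms by (cases x) (auto simp: lookup_single when_def monomials_def inj_on_def)
  then have "Poly_Mapping.lookup (act_mon p m) (i, p j) =
    (\<Sum>x\<in>Poly_Mapping.keys m. if x = (i, j) then Poly_Mapping.lookup m (i, j) else 0)"
    by (auto simp: act_mon_def lookup_sum case_prod_unfold intro!: sum.cong)
  also have "\<dots> = Poly_Mapping.lookup m (i, j)"
    by (auto simp: in_keys_iff)
  finally show ?thesis .
qed

lemma act_mon_inj_on:
  assumes "inj_on p A"
  shows "inj_on (act_mon p) (monomials c A)"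
proof (rule inj_onI)
  fix a b assume ab: "a \<in> monomials c A" "b \<in> monomials c A" "act_mon p a = act_mon p b"
  show "a = b"
  proof (rule poly_mapping_eqI)
    fix x :: "nat \<times> nat"
    obtain i j where x: "x = (i, j)" by force
    show "Poly_Mapping.lookup a x = Poly_Mapping.lookup b x"
    proof (cases "j \<in> A")
      case True
      then show ?thesis using lookup_act_mon[OF _ assms] ab x by metis
    next
      case False
      then have "x \<notin> Poly_Mapping.keys a" "x \<notin> Poly_Mapping.keys b"
        using ab x by (auto simp: monomials_def)
      then show ?thesis by (simp add: in_keys_iff)
    qed
  qed
qed

lemma act_superset:
  assumes "finite X" "Poly_Mapping.keys f \<subseteq> X"
  shows "act p f = (\<Sum>m\<in>X. Poly_Mapping.single (act_mon p m) (Poly_Mapping.lookup f m))"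
  unfolding act_def using assms
  by (intro sum.mono_neutral_left) (auto simp: in_keys_iff)

lemma act_zero [simp]: "act p 0 = 0"
  by (simp add: act_def)

lemma act_single [simp]: "act p (Poly_Mapping.single m a) = Poly_Mapping.single (act_mon p m) a"
  by (subst act_superset[of "{m}"]) auto

lemma act_add: "act p (f + g) = act p f + act p g"
proof -
  let ?X = "Poly_Mapping.keys f \<union> Poly_Mapping.keys g"
  have "Poly_Mapping.keys (f + g) \<subseteq> ?X" using keys_add[of f g] by auto
  then show ?thesis
    by (simp add: act_superset[of ?X] lookup_add single_add sum.distrib)
qed

lemma act_sum: "act p (sum g X) = (\<Sum>x\<in>X. act p (g x))"
  by (induction X rule: infinite_finite_induct) (auto simp: act_add)

lemma act_comp: "act p (act q f) = act (p \<circ> q) f"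
  by (simp add: act_def[of q f] act_def[of "p \<circ> q" f] act_sum act_mon_comp)

lemma act_id: "act id f = f"
  using poly_mapping_sum_singles[of "Poly_Mapping.keys f" f] by (simp add: act_def act_mon_id)

lemma act_cong:
  assumes "f \<in> carrier (polyring c A)" "\<And>j. j \<in> A \<Longrightarrow> p j = q j"
  shows "act p f = act q f"
  unfolding act_def
proof (rule sum.cong)
  fix m assume "m \<in> Poly_Mapping.keys f"
  then have "m \<in> monomials c A" using assms(1) by (auto simp: polyring_def)
  then show "Poly_Mapping.single (act_mon p m) (Poly_Mapping.lookup f m) =
             Poly_Mapping.single (act_mon q m) (Poly_Mapping.lookup f m)"
    using act_mon_cong assms(2) by metis
qed simp

lemma keys_sum_subset: "Poly_Mapping.keys (sum g X) \<subseteq> (\<Union>x\<in>X. Poly_Mapping.keys (g x))"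
proof (induction X rule: infinite_finite_induct)
  case (insert x F)
  then show ?case using keys_add[of "g x" "sum g F"] by auto
qed auto

lemma keys_act_subset: "Poly_Mapping.keys (act p f) \<subseteq> act_mon p ` Poly_Mapping.keys f"
proof -
  have "Poly_Mapping.keys (act p f) \<subseteq>
    (\<Union>m\<in>Poly_Mapping.keys f. Poly_Mapping.keys (Poly_Mapping.single (act_mon p m) (Poly_Mapping.lookup f m)))"
    unfolding act_def by (rule keys_sum_subset)
  then show ?thesis by (fastforce split: if_splits)
qed

lemma act_carrier:
  "f \<in> carrier (polyring c A) \<Longrightarrow> act p f \<in> carrier (polyring c (p ` A))"
  using keys_act_subset[of p f] act_mon_image[of _ c A p] by (fastforce simp: polyring_def)

text \<open>Distinct monomials have distinct images under an injective \<open>p\<close>, so no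
  coefficients are added up and nothing cancels.\<close>

lemma keys_act:
  assumes "f \<in> carrier (polyring c A)" "inj_on p A"
  shows "Poly_Mapping.keys (act p f) = act_mon p ` Poly_Mapping.keys f"
proof
  show "Poly_Mapping.keys (act p f) \<subseteq> act_mon p ` Poly_Mapping.keys f"
    by (rule keys_act_subset)
  have keys: "Poly_Mapping.keys f \<subseteq> monomials c A"
    using assms(1) by (simp add: polyring_def)
  have inj: "inj_on (act_mon p) (Poly_Mapping.keys f)"
    by (rule inj_on_subset[OF act_mon_inj_on[OF assms(2)] keys])
  show "act_mon p ` Poly_Mapping.keys f \<subseteq> Poly_Mapping.keys (act p f)"
  proof
    fix k assume "k \<in> act_mon p ` Poly_Mapping.keys f"
    then obtain m where m: "m \<in> Poly_Mapping.keys f" "k = act_mon p m" by blast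
    have "Poly_Mapping.lookup (Poly_Mapping.single (act_mon p m') (Poly_Mapping.lookup f m')) k =
      (if m' = m then Poly_Mapping.lookup f m else 0)" if "m' \<in> Poly_Mapping.keys f" for m'
      using inj_onD[OF inj, of m' m] that m by (auto simp: lookup_single when_def)
    then have "Poly_Mapping.lookup (act p f) k =
      (\<Sum>m'\<in>Poly_Mapping.keys f. if m' = m then Poly_Mapping.lookup f m else 0)"
      by (auto simp: act_def lookup_sum intro!: sum.cong)
    also have "\<dots> = Poly_Mapping.lookup f m" using m by auto
    finally show "k \<in> Poly_Mapping.keys (act p f)" using m by (simp add: in_keys_iff)
  qed
qed

subsection \<open>Monomial ideals\<close>

text \<open>For \<open>G\<close> inside \<open>monomials c A\<close>, these are the monomials lying
  in the ideal of \<open>polyring c A\<close> generated by \<open>G\<close>.\<close>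

definition multiples :: "nat \<Rightarrow> nat set \<Rightarrow> mon set \<Rightarrow> mon set" where
  "multiples c A G = {g + h |g h. g \<in> G \<and> h \<in> monomials c A}"

lemma multiplesI: "g \<in> G \<Longrightarrow> h \<in> monomials c A \<Longrightarrow> g + h \<in> multiples c A G"
  by (auto simp: multiples_def)

lemma multiples_superset: "G \<subseteq> multiples c A G"
  using multiplesI[of _ G 0] by fastforce

lemma multiples_subset: "G \<subseteq> monomials c A \<Longrightarrow> multiples c A G \<subseteq> monomials c A"
  by (auto simp: multiples_def intro: monomials_add)

lemma multiples_mono: "G \<subseteq> H \<Longrightarrow> multiples c A G \<subseteq> multiples c A H"
  by (auto simp: multiples_def)

lemma multiples_multiples: "multiples c A (multiples c A G) = multiples c A G"
proof
  show "multiples c A (multiples c A G) \<subseteq> multiples c A G"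
    unfolding multiples_def by clarify (metis add.assoc monomials_add)
qed (rule multiples_superset)

text \<open>For arbitrary \<open>M\<close> this is only the linear span of \<open>M\<close>; it is
  an ideal of \<open>polyring c A\<close> once \<open>M\<close> consists of monomials of that ring
  and is closed under multiples.\<close>

definition monomial_ideal :: "mon set \<Rightarrow> ('k::field mpol) set" where
  "monomial_ideal M = {f. Poly_Mapping.keys f \<subseteq> M}"

lemma single_in_monomial_ideal [simp]:
  "Poly_Mapping.single m (1::'k::field) \<in> monomial_ideal M \<longleftrightarrow> m \<in> M"
  by (simp add: monomial_ideal_def)

lemma monomial_ideal_eq_iff [simp]:
  "(monomial_ideal M :: ('k::field mpol) set) = monomial_ideal M' \<longleftrightarrow> M = M'"
  by (metis single_in_monomial_ideal subsetI subset_antisym)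

lemma carrier_polyring: "carrier (polyring c A) = monomial_ideal (monomials c A)"
  by (simp add: polyring_def monomial_ideal_def)

lemma polyring_ops [simp]:
  "monoid.mult (polyring c A) = (*)" "one (polyring c A) = 1"
  "zero (polyring c A) = 0" "add (polyring c A) = (+)"
  by (simp_all add: polyring_def)

lemma ring_polyring: "ring (polyring c A :: ('k::field mpol) ring)"
  using cring_polyring cring.axioms(1) by blast

lemma polyring_idealD:
  fixes J :: "('k::field mpol) set"
  assumes "ideal J (polyring c A)"
  shows "J \<subseteq> carrier (polyring c A)" "0 \<in> J"
    "f \<in> J \<Longrightarrow> g \<in> J \<Longrightarrow> f + g \<in> J"
    "f \<in> J \<Longrightarrow> h \<in> carrier (polyring c A) \<Longrightarrow> h * f \<in> J"
proof -
  interpret ideal J "polyring c A :: ('k mpol) ring" by fact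
  show "J \<subseteq> carrier (polyring c A)" by (rule a_subset)
  show "0 \<in> J" using additive_subgroup.zero_closed[OF is_additive_subgroup] by simp
  show "f \<in> J \<Longrightarrow> g \<in> J \<Longrightarrow> f + g \<in> J"
    using additive_subgroup.a_closed[OF is_additive_subgroup] by simp
  show "f \<in> J \<Longrightarrow> h \<in> carrier (polyring c A) \<Longrightarrow> h * f \<in> J" using I_l_closed by simp
qed

text \<open>Closure under negation follows from closure under multiplication by
  \<open>- 1\<close>.\<close>

lemma polyring_idealI:
  fixes J :: "('k::field mpol) set"
  assumes "J \<subseteq> carrier (polyring c A)" "0 \<in> J"
    "\<And>f g. f \<in> J \<Longrightarrow> g \<in> J \<Longrightarrow> f + g \<in> J"
    "\<And>f h. f \<in> J \<Longrightarrow> h \<in> carrier (polyring c A) \<Longrightarrow> h * f \<in> J"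
  shows "ideal J (polyring c A)"
proof (rule idealI[OF ring_polyring])
  interpret cring "polyring c A :: ('k mpol) ring" by (rule cring_polyring)
  have minus_one: "- 1 \<in> carrier (polyring c A :: ('k mpol) ring)"
    by (simp add: polyring_def)
  have inv: "\<ominus>\<^bsub>polyring c A\<^esub> f = - f" if "f \<in> carrier (polyring c A)" for f :: "'k mpol"
    by (rule minus_equality) (use that in \<open>auto simp: polyring_def\<close>)
  show "subgroup J (add_monoid (polyring c A))"
  proof (rule add.subgroupI)
    show "\<ominus>\<^bsub>polyring c A\<^esub> f \<in> J" if "f \<in> J" for f
      using that assms(4)[OF that minus_one] inv assms(1) by auto
  qed (use assms in auto)
qed (use assms in \<open>auto simp: mult.commute\<close>)

lemma ideal_monomial_ideal:
  assumes "M \<subseteq> monomials c A" "multiples c A M \<subseteq> M"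
  shows "ideal (monomial_ideal M :: ('k::field mpol) set) (polyring c A)"
proof (rule polyring_idealI)
  show "monomial_ideal M \<subseteq> carrier (polyring c A)"
    using assms(1) by (auto simp: carrier_polyring monomial_ideal_def)
  show "f + g \<in> monomial_ideal M" if "f \<in> monomial_ideal M" "g \<in> monomial_ideal M" for f g :: "'k mpol"
    using that keys_add[of f g] by (auto simp: monomial_ideal_def)
  show "h * f \<in> monomial_ideal M" if "f \<in> monomial_ideal M" "h \<in> carrier (polyring c A)"
    for f h :: "'k mpol"
  proof -
    have "a + b \<in> M" if "a \<in> Poly_Mapping.keys h" "b \<in> Poly_Mapping.keys f" for a b
      using that \<open>f \<in> _\<close> \<open>h \<in> _\<close> assms(2) multiplesI[of b M a c A]
      by (auto simp: monomial_ideal_def carrier_polyring add.commute)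
    then show ?thesis using keys_mult[of h f] by (fastforce simp: monomial_ideal_def)
  qed
qed (simp add: monomial_ideal_def)

text \<open>\<open>F\<close> is only sandwiched between the monomials in \<open>G\<close> and the
  ideal they generate, so it may also contain polynomials with several terms. Each term supported on
  a multiple of \<open>G\<close> lies in the generated ideal, and a polynomial is the sum of its
  terms.\<close>

lemma genideal_monomial_ideal:
  fixes F :: "('k::field mpol) set"
  assumes G: "G \<subseteq> monomials c A"
    and single: "\<And>g. g \<in> G \<Longrightarrow> Poly_Mapping.single g 1 \<in> F"
    and F: "F \<subseteq> monomial_ideal (multiples c A G)"
  shows "Idl\<^bsub>polyring c A\<^esub> F = monomial_ideal (multiples c A G)"
proof
  interpret cring "polyring c A :: ('k mpol) ring" by (rule cring_polyring)
  let ?I = "Idl\<^bsub>polyring c A\<^esub> F"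
  have M: "multiples c A G \<subseteq> monomials c A" by (rule multiples_subset[OF G])
  then have Fc: "F \<subseteq> carrier (polyring c A)"
    using F by (force simp: carrier_polyring monomial_ideal_def)
  show "?I \<subseteq> monomial_ideal (multiples c A G)"
    by (rule genideal_minimal[OF _ F], rule ideal_monomial_ideal[OF M])
       (simp add: multiples_multiples)
  have I: "ideal ?I (polyring c A)" by (rule genideal_ideal[OF Fc])
  have monom: "Poly_Mapping.single m a \<in> ?I" if m: "m \<in> multiples c A G" for m and a :: 'k
  proof -
    obtain g h where gh: "g \<in> G" "h \<in> monomials c A" "m = g + h"
      using m by (auto simp: multiples_def)
    have "Poly_Mapping.single h a * Poly_Mapping.single g 1 \<in> ?I"
    proof (rule polyring_idealD(4)[OF I])
      show "Poly_Mapping.single g 1 \<in> ?I" using genideal_self[OF Fc] single gh by blast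
      show "Poly_Mapping.single h a \<in> carrier (polyring c A)"
        using gh(2) by (simp add: carrier_polyring monomial_ideal_def)
    qed
    then show ?thesis by (simp add: mult_single gh add.commute)
  qed
  have sums: "(\<Sum>m\<in>X. Poly_Mapping.single m (a m)) \<in> ?I"
    if "X \<subseteq> multiples c A G" for X and a :: "mon \<Rightarrow> 'k"
    using that
    by (induction X rule: infinite_finite_induct)
       (auto intro: polyring_idealD(2,3)[OF I] monom)
  show "monomial_ideal (multiples c A G) \<subseteq> ?I"
  proof
    fix f :: "'k mpol" assume "f \<in> monomial_ideal (multiples c A G)"
    then have "(\<Sum>m\<in>Poly_Mapping.keys f. Poly_Mapping.single m (Poly_Mapping.lookup f m)) \<in> ?I"
      by (intro sums) (simp add: monomial_ideal_def)
    then show "f \<in> ?I" using poly_mapping_sum_singles[of "Poly_Mapping.keys f" f] by simp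
  qed
qed

text \<open>A polynomial supported in the union splits into its terms in \<open>M\<close> and the
  remaining ones, which then lie in \<open>M'\<close>.\<close>

lemma monomial_ideal_plus:
  "(monomial_ideal M :: ('k::field mpol) set) + monomial_ideal M' = monomial_ideal (M \<union> M')"
proof
  show "monomial_ideal M + monomial_ideal M' \<subseteq> (monomial_ideal (M \<union> M') :: ('k mpol) set)"
  proof
    fix f :: "'k mpol" assume "f \<in> monomial_ideal M + monomial_ideal M'"
    then obtain g h where "f = g + h" "g \<in> monomial_ideal M" "h \<in> monomial_ideal M'"
      by (auto elim: set_plus_elim)
    then show "f \<in> monomial_ideal (M \<union> M')"
      using keys_add[of g h] by (auto simp: monomial_ideal_def)
  qed
  show "(monomial_ideal (M \<union> M') :: ('k mpol) set) \<subseteq> monomial_ideal M + monomial_ideal M'"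
  proof
    fix f :: "'k mpol" assume f: "f \<in> monomial_ideal (M \<union> M')"
    define part where
      "part = (\<lambda>X. \<Sum>m\<in>Poly_Mapping.keys f \<inter> X. Poly_Mapping.single m (Poly_Mapping.lookup f m))"
    have part: "Poly_Mapping.keys (part X) \<subseteq> X" for X
      using keys_sum_subset[of "\<lambda>m. Poly_Mapping.single m (Poly_Mapping.lookup f m)" "Poly_Mapping.keys f \<inter> X"]
      by (fastforce simp: part_def split: if_splits)
    have "f = part M + part (- M)"
      using sum.Int_Diff[of "Poly_Mapping.keys f" "\<lambda>m. Poly_Mapping.single m (Poly_Mapping.lookup f m)" M]
        poly_mapping_sum_singles[of "Poly_Mapping.keys f" f]
      by (simp add: part_def Diff_eq)
    moreover have "Poly_Mapping.keys (part (- M)) \<subseteq> M'"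
    proof -
      have "Poly_Mapping.keys (part (- M)) \<subseteq> Poly_Mapping.keys f"
        using keys_sum_subset[of "\<lambda>m. Poly_Mapping.single m (Poly_Mapping.lookup f m)" "Poly_Mapping.keys f \<inter> - M"]
        by (fastforce simp: part_def split: if_splits)
      then show ?thesis using part[of "- M"] f by (auto simp: monomial_ideal_def)
    qed
    ultimately show "f \<in> monomial_ideal M + monomial_ideal M'"
      using part[of M] by (metis (mono_tags, lifting) mem_Collect_eq monomial_ideal_def set_plus_intro)
  qed
qed

lemma monomial_ideal_sum:
  assumes "finite X"
  shows "(\<Sum>x\<in>X. monomial_ideal (M x) :: ('k::field mpol) set) = monomial_ideal (\<Union>x\<in>X. M x)"
  using assms
proof (induction X)
  case empty
  show ?case by (auto simp: monomial_ideal_def)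
qed (simp add: monomial_ideal_plus)

subsection \<open>Noetherianity of monomials\<close>

lemma poly_mapping_le_imp_add:
  fixes a b :: "'a \<Rightarrow>\<^sub>0 nat"
  assumes "\<And>x. Poly_Mapping.lookup a x \<le> Poly_Mapping.lookup b x"
  shows "b = a + (b - a)"
  using assms by (intro poly_mapping_eqI) (simp add: lookup_add lookup_minus)

lemma dickson_monomials:
  fixes w :: "nat \<Rightarrow> mon"
  assumes "finite A" "\<And>k. w k \<in> monomials c A"
  shows "\<exists>i j. i < j \<and> (\<exists>h\<in>monomials c A. w j = w i + h)"
proof -
  obtain \<phi> :: "nat \<Rightarrow> nat" where \<phi>: "strict_mono \<phi>"
    "\<forall>i j. i \<le> j \<longrightarrow> (\<forall>s\<in>{1..c} \<times> A. Poly_Mapping.lookup (w (\<phi> i)) s \<le> Poly_Mapping.lookup (w (\<phi> j)) s)"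
    using dickson_subseq[of "{1..c} \<times> A" "\<lambda>k. Poly_Mapping.lookup (w k)"] assms(1) by auto
  have "Poly_Mapping.lookup (w (\<phi> 0)) s \<le> Poly_Mapping.lookup (w (\<phi> 1)) s" for s
  proof (cases "s \<in> {1..c} \<times> A")
    case False
    then have "s \<notin> Poly_Mapping.keys (w (\<phi> 0))" using assms(2)[of "\<phi> 0"] by (auto simp: monomials_def)
    then show ?thesis by (simp add: in_keys_iff)
  qed (use \<phi>(2) in auto)
  then have eq: "w (\<phi> 1) = w (\<phi> 0) + (w (\<phi> 1) - w (\<phi> 0))"
    by (rule poly_mapping_le_imp_add)
  then have "w (\<phi> 1) - w (\<phi> 0) \<in> monomials c A"
    using monomials_addD(2) assms(2) by metis
  moreover have "\<phi> 0 < \<phi> 1" using \<phi>(1) by (simp add: strict_mono_less)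
  ultimately show ?thesis using eq by blast
qed

text \<open>Higman's lemma for words whose letters are the columns of exponents, compared entrywise.
  The positions given by the embedding define the increasing map, and the excess of exponents is the
  cofactor \<open>h\<close>.\<close>

lemma higman_monomials:
  fixes n :: "nat \<Rightarrow> nat"
  assumes "\<And>k. n k \<ge> 1" "\<And>k. w k \<in> monomials c {1..n k}"
  shows "\<exists>i j. i < j \<and> (\<exists>p\<in>Inc_mn (n i) (n j). \<exists>h\<in>monomials c {1..n j}. w j = act_mon p (w i) + h)"
proof -
  define P :: "(nat \<Rightarrow> nat) \<Rightarrow> (nat \<Rightarrow> nat) \<Rightarrow> bool" where "P = (\<lambda>a b. \<forall>i\<in>{1..c}. a i \<le> b i)"
  \<comment> \<open>Letter \<open>l\<close> is column \<open>Suc l\<close>: letters are numbered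
    from 0, columns from 1.\<close>
  define word where "word = (\<lambda>k. map (\<lambda>l i. Poly_Mapping.lookup (w k) (i, Suc l)) [0..<n k])"
  have "\<exists>i j. i < j \<and> list_emb P (word i) (word j)"
  proof (rule higman)
    fix s :: "nat \<Rightarrow> nat \<Rightarrow> nat"
    show "\<exists>\<phi>::nat \<Rightarrow> nat. strict_mono \<phi> \<and> (\<forall>i j. i < j \<longrightarrow> P (s (\<phi> i)) (s (\<phi> j)))"
      using dickson_subseq[of "{1..c}" s] unfolding P_def by (meson finite_atLeastAtMost less_imp_le)
  qed
  then obtain a b where ab: "a < b" "list_emb P (word a) (word b)" by blast
  have len: "length (word k) = n k" for k by (simp add: word_def)
  obtain f where f: "strict_mono_on {..<n a} f"
    "\<And>l. l < n a \<Longrightarrow> f l < n b \<and> P (word a ! l) (word b ! f l)"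
    using list_emb_index_map[OF ab(2)] by (auto simp: len)
  \<comment> \<open>The embedding transported from letter positions to columns; beyond
    \<open>n a\<close> it is continued as in \<open>Inc_mn_extend\<close>.\<close>
  define p where "p = (\<lambda>j. if j \<le> n a then Suc (f (j - 1)) else n b + j)"
  have p_in: "p \<in> Inc_mn (n a) (n b)"
    unfolding p_def
  proof (rule Inc_mn_extend[OF _ _ assms(1)])
    show "strict_mono_on {1..n a} (\<lambda>j. Suc (f (j - 1)))"
    proof (rule strict_mono_onI)
      fix a' b' assume "a' \<in> {1..n a}" "b' \<in> {1..n a}" "a' < b'"
      then have "a' - 1 \<in> {..<n a}" "b' - 1 \<in> {..<n a}" "a' - 1 < b' - 1" by auto
      then show "Suc (f (a' - 1)) < Suc (f (b' - 1))"
        using strict_mono_onD[OF f(1)] by simp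
    qed
    show "(\<lambda>j. Suc (f (j - 1))) ` {1..n a} \<subseteq> {1..n b}"
    proof (intro image_subsetI)
      fix j assume "j \<in> {1..n a}"
      then have "j - 1 < n a" by auto
      then show "Suc (f (j - 1)) \<in> {1..n b}" using f(2)[of "j - 1"] by (simp add: Suc_le_eq)
    qed
  qed
  have inj: "inj_on p {1..n a}"
    using p_in IncD(1) inj_on_subset[of p "{1..}" "{1..n a}"] by (auto simp: Inc_mn_def)
  have "Poly_Mapping.lookup (act_mon p (w a)) x \<le> Poly_Mapping.lookup (w b) x" for x
  proof (cases "x \<in> Poly_Mapping.keys (act_mon p (w a))")
    case True
    then obtain i j where x: "x = (i, p j)" and ij: "i \<in> {1..c}" "j \<in> {1..n a}"
      using act_mon_image[OF assms(2), of p a] by (auto simp: monomials_def)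
    have "P (word a ! (j - 1)) (word b ! f (j - 1))" "f (j - 1) < n b" "j - 1 < n a"
      using f(2)[of "j - 1"] ij(2) by auto
    moreover have "Suc (j - 1) = j" using ij(2) by simp
    ultimately have "Poly_Mapping.lookup (w a) (i, j) \<le> Poly_Mapping.lookup (w b) (i, p j)"
      using ij by (auto simp: P_def word_def p_def)
    then show ?thesis using lookup_act_mon[OF assms(2) inj ij(2)] x by simp
  qed (simp add: in_keys_iff)
  then have eq: "w b = act_mon p (w a) + (w b - act_mon p (w a))"
    by (rule poly_mapping_le_imp_add)
  then have "w b - act_mon p (w a) \<in> monomials c {1..n b}"
    using monomials_addD(2) assms(2) by metis
  then show ?thesis using eq p_in ab(1) by blast
qed

text \<open>The case of monomial chains of the theorem of Hillar and Sullivant.\<close>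

lemma monomial_chain_stabilizes:
  fixes X :: "nat \<Rightarrow> mon set"
  assumes sub: "\<And>n. n \<ge> 1 \<Longrightarrow> X n \<subseteq> monomials c {1..n}"
    and up: "\<And>n. n \<ge> 1 \<Longrightarrow> multiples c {1..n} (X n) \<subseteq> X n"
    and inv: "\<And>m n p. 1 \<le> m \<Longrightarrow> m \<le> n \<Longrightarrow> p \<in> Inc_mn m n \<Longrightarrow> act_mon p ` X m \<subseteq> X n"
  shows "\<exists>N\<ge>1. \<forall>n\<ge>N. multiples c {1..n} {act_mon p m |p m. p \<in> Inc_mn N n \<and> m \<in> X N} = X n"
proof (rule ccontr)
  let ?U = "\<lambda>N n. multiples c {1..n} {act_mon p m |p m. p \<in> Inc_mn N n \<and> m \<in> X N}"
  have U: "?U N n \<subseteq> X n" if "1 \<le> N" "N \<le> n" for N n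
  proof -
    have "{act_mon p m |p m. p \<in> Inc_mn N n \<and> m \<in> X N} \<subseteq> X n" using inv[OF that] by blast
    then show ?thesis using multiples_mono up[of n] that by (meson le_trans order_trans)
  qed
  assume contra: "\<not> ?thesis"
  define gap where "gap = (\<lambda>N n m. n \<ge> N \<and> m \<in> X n - ?U N n)"
  have "\<forall>N. \<exists>n m. N \<ge> 1 \<longrightarrow> gap N n m" using contra U unfolding gap_def by blast
  then obtain n w where "\<And>N. N \<ge> 1 \<Longrightarrow> gap N (n N) (w N)" by metis
  then have nw: "n N \<ge> N \<and> w N \<in> X (n N) - ?U N (n N)" if "N \<ge> 1" for N
    using that unfolding gap_def by blast
  \<comment> \<open>Iterating \<open>n\<close> from 1 gives levels \<open>a k\<close> such that
    \<open>w (a k)\<close> lies in level \<open>a (Suc k)\<close> but is not generated from level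
    \<open>a k\<close>.\<close>
  define a where "a = rec_nat 1 (\<lambda>_. n)"
  have a_Suc: "a (Suc k) = n (a k)" for k by (simp add: a_def)
  have a1: "a k \<ge> 1" for k
  proof (induction k)
    case (Suc k)
    then show ?case using nw[of "a k"] by (simp add: a_Suc)
  qed (simp add: a_def)
  have "a k \<le> a (Suc k)" for k using nw[OF a1[of k]] by (simp add: a_Suc)
  then have a_mono: "a k \<le> a l" if "k \<le> l" for k l using that lift_Suc_mono_le by blast
  have wX: "w (a k) \<in> X (a (Suc k))" for k using nw[OF a1[of k]] by (simp add: a_Suc)
  then obtain i j p h where ij: "i < j" "p \<in> Inc_mn (a (Suc i)) (a (Suc j))"
    "h \<in> monomials c {1..a (Suc j)}" "w (a j) = act_mon p (w (a i)) + h"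
    using higman_monomials[of "\<lambda>k. a (Suc k)" "\<lambda>k. w (a k)" c] a1 sub[OF a1] by (metis in_mono)
  \<comment> \<open>The increasing map leads from level \<open>a (Suc i)\<close> to level
    \<open>a (Suc j)\<close>, and level \<open>a j\<close> lies between them because
    \<open>i < j\<close>. Factoring through it shows that \<open>w (a j)\<close> is generated from
    level \<open>a j\<close> after all.\<close>
  obtain q p' where qp: "q \<in> Inc_mn (a j) (a (Suc j))" "p' \<in> Inc_mn (a (Suc i)) (a j)"
    "\<forall>l\<in>{1..a (Suc i)}. p l = q (p' l)"
    using Inc_mn_factor[OF ij(2) a1, of "a j"] a_mono ij(1) by auto
  have "act_mon p (w (a i)) = act_mon q (act_mon p' (w (a i)))"
    using act_mon_cong[of "w (a i)" c "{1..a (Suc i)}" p "q \<circ> p'"] qp(3) wX sub[OF a1]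
    by (auto simp: act_mon_comp)
  moreover have "act_mon p' (w (a i)) \<in> X (a j)"
    using inv[OF a1 a_mono qp(2)] ij(1) wX[of i] by (simp add: image_subset_iff)
  ultimately have "w (a j) \<in> ?U (a j) (a (Suc j))"
    unfolding ij(4) by (intro multiplesI[OF _ ij(3)]) (use qp(1) in auto)
  then show False using nw[OF a1[of j]] by (simp add: a_Suc)
qed

text \<open>The ascending chain condition, with larger sets counted as smaller. In an infinite
  ascent pick a new monomial at each stage; by Dickson's lemma one of them divides a later one,
  which was therefore present already.\<close>

lemma wf_monomial_ideals:
  assumes "finite A"
  shows "wf {(M', M). M \<subset> M' \<and> M' \<subseteq> monomials c A \<and> multiples c A M \<subseteq> M}"
  unfolding wf_iff_no_infinite_down_chain
proof
  assume "\<exists>S. \<forall>k. (S (Suc k), S k) \<in> {(M', M). M \<subset> M' \<and> M' \<subseteq> monomials c A \<and> multiples c A M \<subseteq> M}"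
  then obtain S where "\<forall>k. (S (Suc k), S k) \<in> {(M', M). M \<subset> M' \<and> M' \<subseteq> monomials c A \<and> multiples c A M \<subseteq> M}" ..
  then have S: "S k \<subset> S (Suc k)" "S (Suc k) \<subseteq> monomials c A" "multiples c A (S k) \<subseteq> S k" for k
    by simp_all
  have mono: "S k \<subseteq> S l" if "k \<le> l" for k l
    using that lift_Suc_mono_le[of S] S(1) by blast
  have "\<forall>k. \<exists>m. m \<in> S (Suc k) - S k" using S(1) by blast
  then obtain w where w: "\<And>k. w k \<in> S (Suc k) - S k" by metis
  then obtain i j h where ij: "i < j" "h \<in> monomials c A" "w j = w i + h"
    using dickson_monomials[OF assms, of w c] S(2) by blast
  have "w i \<in> S j" using w[of i] mono[of "Suc i" j] ij(1) by auto
  then have "w j \<in> S j" using S(3) multiplesI[OF _ ij(2)] ij(3) by auto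
  then show False using w by blast
qed

lemma multiples_Un: "multiples c A (G \<union> H) = multiples c A G \<union> multiples c A H"
  by (auto simp: multiples_def)

subsection \<open>Leading monomials\<close>

definition lead_mons :: "mon rel \<Rightarrow> ('k::field mpol) set \<Rightarrow> mon set" where
  "lead_mons r J = {lead_mon r f |f. f \<in> J \<and> f \<noteq> 0}"

lemma lookup_single_times:
  fixes f :: "'k::field mpol"
  shows "Poly_Mapping.lookup (Poly_Mapping.single h a * f) (h + m) = a * Poly_Mapping.lookup f m"
proof -
  have "Poly_Mapping.single h a * f =
    (\<Sum>k\<in>Poly_Mapping.keys f. Poly_Mapping.single (h + k) (a * Poly_Mapping.lookup f k))"
    by (subst poly_mapping_sum_singles[of "Poly_Mapping.keys f" f])
       (auto simp: sum_distrib_left mult_single)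
  then show ?thesis
    by (auto simp: lookup_sum lookup_single when_def in_keys_iff)
qed

lemma linear_order_on_finite_greatest:
  assumes "linear_order_on S r" "finite X" "X \<noteq> {}" "X \<subseteq> S"
  shows "\<exists>m\<in>X. \<forall>x\<in>X. (x, m) \<in> r"
  using assms(2-4)
proof (induction rule: finite_ne_induct)
  case (singleton x)
  then show ?case using assms(1) by (auto simp: order_on_defs refl_on_def)
next
  case (insert x F)
  then obtain m where m: "m \<in> F" "\<forall>y\<in>F. (y, m) \<in> r" by auto
  have refl: "(x, x) \<in> r" using assms(1) insert.prems by (auto simp: order_on_defs refl_on_def)
  have "(x, m) \<in> r \<or> (m, x) \<in> r"
    using assms(1) m(1) insert.prems refl by (auto simp: order_on_defs total_on_def)
  then show ?case
  proof
    assume "(m, x) \<in> r"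
    moreover have "trans r" using assms(1) by (simp add: order_on_defs)
    ultimately have "\<forall>y\<in>insert x F. (y, x) \<in> r" using m refl by (auto dest: transD)
    then show ?thesis by blast
  qed (use m in auto)
qed

context
  fixes c :: nat and r :: "mon rel"
  assumes order: "term_order c r"
begin

lemma term_order_linear: "linear_order_on (monomials c {1..}) r"
  using order by (simp add: term_order_def)

lemma term_order_trans: "(a, b) \<in> r \<Longrightarrow> (b, d) \<in> r \<Longrightarrow> (a, d) \<in> r"
  using term_order_linear by (auto simp: order_on_defs dest: transD)

lemma term_order_antisym: "(a, b) \<in> r \<Longrightarrow> (b, a) \<in> r \<Longrightarrow> a = b"
  using term_order_linear by (auto simp: order_on_defs dest: antisymD)

lemma term_order_refl: "a \<in> monomials c {1..} \<Longrightarrow> (a, a) \<in> r"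
  using term_order_linear by (auto simp: order_on_defs refl_on_def)

lemma term_order_total: "a \<in> monomials c {1..} \<Longrightarrow> b \<in> monomials c {1..} \<Longrightarrow> (a, b) \<in> r \<or> (b, a) \<in> r"
  using term_order_linear term_order_refl by (cases "a = b") (auto simp: order_on_defs total_on_def)

lemma term_order_add: "(a, b) \<in> r \<Longrightarrow> h \<in> monomials c {1..} \<Longrightarrow> (a + h, b + h) \<in> r"
  using order by (simp add: term_order_def)

lemma term_order_multiple:
  assumes "a \<in> monomials c {1..}" "h \<in> monomials c {1..}"
  shows "(a, a + h) \<in> r"
  using term_order_add[of 0 h a] order assms by (simp add: term_order_def add.commute)

lemma lead_mon_eqI:
  assumes "m \<in> Poly_Mapping.keys f" "\<And>m'. m' \<in> Poly_Mapping.keys f \<Longrightarrow> (m', m) \<in> r"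
  shows "lead_mon r f = m"
  unfolding lead_mon_def using assms by (intro the_equality) (auto intro: term_order_antisym)

text \<open>On finitely many columns a term order is a well-order: in a strictly descending sequence
  Dickson's lemma finds a term dividing a later one, but divisors are never larger.\<close>

lemma term_order_has_minimum:
  assumes A: "finite A" "A \<subseteq> {1..}" and X: "X \<subseteq> monomials c A" "X \<noteq> {}"
  shows "\<exists>m\<in>X. \<forall>x\<in>X. (m, x) \<in> r"
proof -
  let ?s = "{(a, b). a \<in> monomials c A \<and> b \<in> monomials c A \<and> (a, b) \<in> r \<and> a \<noteq> b}"
  have mon: "a \<in> monomials c {1..}" if "a \<in> monomials c A" for a
    using that monomials_mono[OF A(2)] by blast
  have "wf ?s"
    unfolding wf_iff_no_infinite_down_chain
  proof
    assume "\<exists>w. \<forall>k. (w (Suc k), w k) \<in> ?s"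
    then obtain w where w: "\<And>k. w k \<in> monomials c A" "\<And>k. (w (Suc k), w k) \<in> r"
      "\<And>k. w (Suc k) \<noteq> w k" by blast
    have dec: "(w l, w k) \<in> r" if "k \<le> l" for k l
      using that by (induction l rule: dec_induct) (auto intro: term_order_refl mon w term_order_trans)
    obtain i j h where ij: "i < j" "h \<in> monomials c A" "w j = w i + h"
      using dickson_monomials[OF A(1), of w c] w(1) by blast
    then have "(w i, w j) \<in> r" using term_order_multiple mon w(1) by metis
    moreover have "(w j, w (Suc i)) \<in> r" using dec ij(1) by simp
    ultimately have "w (Suc i) = w i"
      using term_order_antisym term_order_trans w(2) by blast
    then show False using w(3) by blast
  qed
  moreover obtain x where "x \<in> X" using X(2) by blast
  ultimately have "\<exists>m\<in>X. \<forall>y. (y, m) \<in> ?s \<longrightarrow> y \<notin> X"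
    by (simp only: wf_eq_minimal)
  then obtain m where m: "m \<in> X" "\<forall>y. (y, m) \<in> ?s \<longrightarrow> y \<notin> X" ..
  have "(m, x) \<in> r" if "x \<in> X" for x
    using m(2)[rule_format, of x] that X(1) m(1) term_order_total[of m x] term_order_refl mon by blast
  then show ?thesis using m(1) by blast
qed

context
  fixes A :: "nat set"
  assumes A: "A \<subseteq> {1..}"
begin

lemma keys_in_monomials:
  assumes "f \<in> carrier (polyring c A)" "m \<in> Poly_Mapping.keys f"
  shows "m \<in> monomials c A" "m \<in> monomials c {1..}"
  using assms monomials_mono[OF A] by (auto simp: polyring_def)

lemma lead_mon_greatest:
  fixes f :: "'k::field mpol"
  assumes "f \<in> carrier (polyring c A)" "f \<noteq> 0"
  shows "lead_mon r f \<in> Poly_Mapping.keys f"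
    "m \<in> Poly_Mapping.keys f \<Longrightarrow> (m, lead_mon r f) \<in> r"
proof -
  have "Poly_Mapping.keys f \<noteq> {}" using assms(2) by simp
  then obtain l where l: "l \<in> Poly_Mapping.keys f" "\<forall>x\<in>Poly_Mapping.keys f. (x, l) \<in> r"
    using linear_order_on_finite_greatest[OF term_order_linear finite_keys[of f]]
      keys_in_monomials(2)[OF assms(1)] by blast
  then have "lead_mon r f = l" by (intro lead_mon_eqI) auto
  then show "lead_mon r f \<in> Poly_Mapping.keys f"
    "m \<in> Poly_Mapping.keys f \<Longrightarrow> (m, lead_mon r f) \<in> r" using l by auto
qed

context
  fixes J :: "('k::field mpol) set"
  assumes J: "ideal J (polyring c A)"
begin

lemma lead_mons_monomials: "lead_mons r J \<subseteq> monomials c A"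
  using lead_mon_greatest(1) keys_in_monomials(1) polyring_idealD(1)[OF J]
  by (fastforce simp: lead_mons_def)

text \<open>Multiplying \<open>f\<close> by the monomial \<open>h\<close> shifts all its monomials
  by \<open>h\<close>, and the order respects this shift.\<close>

lemma lead_mons_multiples: "multiples c A (lead_mons r J) \<subseteq> lead_mons r J"
proof
  fix m assume "m \<in> multiples c A (lead_mons r J)"
  then obtain f h where f: "f \<in> J" "f \<noteq> 0" and h: "h \<in> monomials c A" and m: "m = lead_mon r f + h"
    by (auto simp: multiples_def lead_mons_def)
  have fc: "f \<in> carrier (polyring c A)" using f(1) polyring_idealD(1)[OF J] by blast
  let ?g = "Poly_Mapping.single h 1 * f"
  have lookup: "Poly_Mapping.lookup ?g (h + k) = Poly_Mapping.lookup f k" for k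
    by (simp add: lookup_single_times)
  have m_in: "m \<in> Poly_Mapping.keys ?g"
    using lead_mon_greatest(1)[OF fc f(2)]
    unfolding m add.commute[of "lead_mon r f" h] in_keys_iff lookup .
  have "lead_mon r ?g = m"
  proof (rule lead_mon_eqI[OF m_in])
    fix k assume "k \<in> Poly_Mapping.keys ?g"
    then obtain l where l: "k = h + l" "l \<in> Poly_Mapping.keys f"
      using keys_mult[of "Poly_Mapping.single h 1" f] by auto
    have "(l + h, lead_mon r f + h) \<in> r"
      using term_order_add[OF lead_mon_greatest(2)[OF fc f(2) l(2)]] h monomials_mono[OF A] by blast
    then show "(k, m) \<in> r" by (simp only: l(1) m add.commute[of h l])
  qed
  moreover have "?g \<in> J"
    using h f(1) by (intro polyring_idealD(4)[OF J]) (auto simp: polyring_def)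
  moreover have "?g \<noteq> 0" using m_in by auto
  ultimately show "m \<in> lead_mons r J" by (auto simp: lead_mons_def)
qed

text \<open>The leading monomials are already closed under multiples, so the ideal they generate
  contains no further monomials.\<close>

lemma init_ideal_eq: "init_ideal c r A J = monomial_ideal (lead_mons r J)"
proof -
  have eq: "multiples c A (lead_mons r J) = lead_mons r J"
    using lead_mons_multiples multiples_superset by blast
  have "init_ideal c r A J = monomial_ideal (multiples c A (lead_mons r J))"
    unfolding init_ideal_def
    by (rule genideal_monomial_ideal[OF lead_mons_monomials], unfold eq)
       (auto simp: lead_mons_def monomial_ideal_def)
  then show ?thesis by (simp add: eq)
qed

end

section \<open>Reduction by leading monomials\<close>

text \<open>One reduction step: a scalar multiple of \<open>g\<close> removes the monomial
  \<open>lead_mon r g\<close> from \<open>f\<close>. The scalar \<open>a\<close> appears as the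
  constant polynomial \<open>single 0 a\<close>, and only coefficients at monomials up to the
  leading one of \<open>g\<close> can change.\<close>

lemma cancel_monomial:
  fixes f g :: "'k::field mpol"
  assumes "g \<in> carrier (polyring c A)" "g \<noteq> 0"
  obtains a f' where "f' = f + Poly_Mapping.single 0 a * g"
    "Poly_Mapping.lookup f' (lead_mon r g) = 0"
    "\<And>m. (m, lead_mon r g) \<notin> r \<Longrightarrow> Poly_Mapping.lookup f' m = Poly_Mapping.lookup f m"
proof -
  define a where "a = - Poly_Mapping.lookup f (lead_mon r g) / Poly_Mapping.lookup g (lead_mon r g)"
  have lookup: "Poly_Mapping.lookup (f + Poly_Mapping.single 0 a * g) m =
    Poly_Mapping.lookup f m + a * Poly_Mapping.lookup g m" for m
    using lookup_single_times[of 0 a g m] by (simp add: lookup_add)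
  show thesis
  proof (rule that[OF refl])
    show "Poly_Mapping.lookup (f + Poly_Mapping.single 0 a * g) (lead_mon r g) = 0"
      using lead_mon_greatest(1)[OF assms] unfolding lookup by (simp add: a_def in_keys_iff)
    show "Poly_Mapping.lookup (f + Poly_Mapping.single 0 a * g) m = Poly_Mapping.lookup f m"
      if "(m, lead_mon r g) \<notin> r" for m
      using lead_mon_greatest(2)[OF assms] that by (auto simp: lookup in_keys_iff)
  qed
qed

context
  fixes J :: "('k::field mpol) set"
  assumes J: "ideal J (polyring c A)" and finA: "finite A"
begin

lemma add_scaled_in_ideal:
  "f \<in> J \<Longrightarrow> g \<in> J \<Longrightarrow> f + Poly_Mapping.single 0 a * g \<in> J"
  using J by (auto intro!: polyring_idealD(3,4)[OF J] simp: polyring_def)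

text \<open>Tail reduction: among the \<open>f \<in> J\<close> with leading monomial \<open>m\<close> pick one whose largest
  monomial in \<open>M\<close> is minimal.\<close>

lemma exists_reduced:
  assumes M: "M \<subseteq> lead_mons r J" and m: "m \<in> lead_mons r J" "m \<notin> M"
  shows "\<exists>f\<in>J. f \<noteq> 0 \<and> Poly_Mapping.keys f \<inter> M = {}"
proof (rule ccontr)
  assume contra: "\<not> ?thesis"
  define top :: "'k mpol \<Rightarrow> mon \<Rightarrow> bool" where "top = (\<lambda>f t. t \<in> Poly_Mapping.keys f \<inter> M \<and> (\<forall>x\<in>Poly_Mapping.keys f \<inter> M. (x, t) \<in> r))"
  \<comment> \<open>Assuming the contrary, every nonzero element of \<open>J\<close> has a largest
    monomial in \<open>M\<close>. \<open>T\<close> collects these over the elements with leading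
    monomial \<open>m\<close>; its least member \<open>t\<close> is to be undercut.\<close>
  define T where "T = {t. \<exists>f\<in>J. f \<noteq> 0 \<and> lead_mon r f = m \<and> top f t}"
  have carr: "f \<in> carrier (polyring c A)" if "f \<in> J" for f
    using that polyring_idealD(1)[OF J] by blast
  have ex_top: "\<exists>t. top f t" if "f \<in> J" "f \<noteq> 0" for f
  proof -
    have "Poly_Mapping.keys f \<inter> M \<noteq> {}" using contra that by blast
    then show ?thesis
      using linear_order_on_finite_greatest[OF term_order_linear, of "Poly_Mapping.keys f \<inter> M"]
        keys_in_monomials(2)[OF carr[OF that(1)]] by (auto simp: top_def)
  qed
  obtain f0 where "f0 \<in> J" "f0 \<noteq> 0" "lead_mon r f0 = m" using m(1) by (auto simp: lead_mons_def)
  then have ne_T: "T \<noteq> {}" using ex_top[of f0] unfolding T_def by blast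
  have "T \<subseteq> monomials c A"
    using keys_in_monomials(1) carr by (auto simp: T_def top_def)
  then have "\<exists>t\<in>T. \<forall>x\<in>T. (t, x) \<in> r"
    using ne_T by (rule term_order_has_minimum[OF finA A])
  then obtain t where t: "t \<in> T" "\<And>x. x \<in> T \<Longrightarrow> (t, x) \<in> r" by blast
  then obtain f where f: "f \<in> J" "f \<noteq> 0" "lead_mon r f = m" "top f t" by (auto simp: T_def)
  have tM: "t \<in> M" "t \<in> Poly_Mapping.keys f" using f(4) by (auto simp: top_def)
  \<comment> \<open>All of \<open>M\<close> consists of leading monomials, so some \<open>g\<close>
    in \<open>J\<close> can cancel \<open>t\<close>.\<close>
  then obtain g where g: "g \<in> J" "g \<noteq> 0" "lead_mon r g = t" using M by (auto simp: lead_mons_def)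
  obtain a f' where f': "f' = f + Poly_Mapping.single 0 a * g" "Poly_Mapping.lookup f' t = 0"
    "\<And>x. (x, t) \<notin> r \<Longrightarrow> Poly_Mapping.lookup f' x = Poly_Mapping.lookup f x"
    by (rule cancel_monomial[OF carr[OF g(1)] g(2), of f, unfolded g(3)]) blast
  have "f' \<in> J" unfolding f'(1) by (rule add_scaled_in_ideal[OF f(1) g(1)])
  have tm: "(t, m) \<in> r" using lead_mon_greatest(2)[OF carr[OF f(1)] f(2) tM(2)] f(3) by simp
  \<comment> \<open>As \<open>m\<close> is outside \<open>M\<close>, it differs from
    \<open>t\<close> and lies strictly above it; the cancellation leaves the leading monomial
    intact.\<close>
  then have "(m, t) \<notin> r" using term_order_antisym tM(1) m(2) by blast
  then have m_in: "m \<in> Poly_Mapping.keys f'"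
    using f'(3)[of m] lead_mon_greatest(1)[OF carr[OF f(1)] f(2)] f(3) by (simp add: in_keys_iff)
  then have "f' \<noteq> 0" by auto
  have "lead_mon r f' = m"
  proof (rule lead_mon_eqI[OF m_in])
    fix x assume "x \<in> Poly_Mapping.keys f'"
    show "(x, m) \<in> r"
    proof (cases "(x, t) \<in> r")
      case True
      then show ?thesis using tm term_order_trans by blast
    next
      case False
      then have "x \<in> Poly_Mapping.keys f" using \<open>x \<in> Poly_Mapping.keys f'\<close> f'(3) by (simp add: in_keys_iff)
      then show ?thesis using lead_mon_greatest(2)[OF carr[OF f(1)] f(2)] f(3) by blast
    qed
  qed
  moreover obtain s where s: "top f' s" using ex_top[OF \<open>f' \<in> J\<close> \<open>f' \<noteq> 0\<close>] by blast
  ultimately have "(t, s) \<in> r" using t(2) \<open>f' \<in> J\<close> \<open>f' \<noteq> 0\<close> by (auto simp: T_def)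
  have sk: "s \<in> Poly_Mapping.keys f'" "s \<in> M" using s by (auto simp: top_def)
  \<comment> \<open>Above \<open>t\<close> the polynomials \<open>f\<close> and \<open>f'\<close>
    agree, so \<open>f'\<close> has no monomial of \<open>M\<close> there. Minimality of
    \<open>t\<close> then forces \<open>s = t\<close>, although \<open>t\<close> was
    cancelled.\<close>
  have "(s, t) \<in> r"
  proof (rule ccontr)
    assume st: "(s, t) \<notin> r"
    then have "s \<in> Poly_Mapping.keys f" using f'(3) sk(1) by (simp add: in_keys_iff)
    then show False using f(4) sk(2) st by (auto simp: top_def)
  qed
  then have "s = t" using \<open>(t, s) \<in> r\<close> term_order_antisym by blast
  then show False using sk(1) f'(2) by (simp add: in_keys_iff)
qed

text \<open>Take an element of \<open>J - I\<close> with least leading monomial. Cancelling this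
  monomial with an element of \<open>I\<close> stays in \<open>J - I\<close> but makes the leading
  monomial smaller.\<close>

lemma ideal_eq_if_lead_mons_eq:
  assumes I: "ideal I (polyring c A)" "I \<subseteq> J" and eq: "lead_mons r I = lead_mons r J"
  shows "I = J"
proof (rule ccontr)
  assume "I \<noteq> J"
  have carr: "f \<in> carrier (polyring c A)" if "f \<in> J" for f
    using that polyring_idealD(1)[OF J] by blast
  have ne: "f \<noteq> 0" if "f \<notin> I" for f using that polyring_idealD(2)[OF I(1)] by blast
  define T where "T = lead_mon r ` (J - I)"
  have ne_T: "T \<noteq> {}" using \<open>I \<noteq> J\<close> I(2) by (auto simp: T_def)
  have "T \<subseteq> monomials c A"
    using lead_mon_greatest(1) ne carr keys_in_monomials(1) by (fastforce simp: T_def)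
  then have "\<exists>t\<in>T. \<forall>x\<in>T. (t, x) \<in> r"
    using ne_T by (rule term_order_has_minimum[OF finA A])
  then obtain t where t: "t \<in> T" "\<And>x. x \<in> T \<Longrightarrow> (t, x) \<in> r" by blast
  then obtain f where f: "f \<in> J" "f \<notin> I" "lead_mon r f = t" by (auto simp: T_def)
  then have "t \<in> lead_mons r I" using ne eq by (auto simp: lead_mons_def)
  then obtain g where g: "g \<in> I" "g \<noteq> 0" "lead_mon r g = t" by (auto simp: lead_mons_def)
  have gJ: "g \<in> J" using g(1) I(2) by blast
  obtain a f' where f': "f' = f + Poly_Mapping.single 0 a * g" "Poly_Mapping.lookup f' t = 0"
    "\<And>x. (x, t) \<notin> r \<Longrightarrow> Poly_Mapping.lookup f' x = Poly_Mapping.lookup f x"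
    by (rule cancel_monomial[OF carr[OF gJ] g(2), of f, unfolded g(3)]) blast
  have f'J: "f' \<in> J" unfolding f'(1) by (rule add_scaled_in_ideal[OF f(1) gJ])
  have "f' \<notin> I"
  proof
    assume "f' \<in> I"
    then have "f' + Poly_Mapping.single 0 (- a) * g \<in> I"
      using g(1) I(1) by (auto intro!: polyring_idealD(3,4)[OF I(1)] simp: polyring_def)
    moreover have "f' + Poly_Mapping.single 0 (- a) * g = f"
      by (simp add: f'(1) single_uminus)
    ultimately show False using f(2) by simp
  qed
  then have "f' \<noteq> 0" "(t, lead_mon r f') \<in> r" using ne f'J t(2) by (auto simp: T_def)
  note lead = lead_mon_greatest(1)[OF carr[OF f'J] \<open>f' \<noteq> 0\<close>]
  have "(lead_mon r f', t) \<in> r"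
  proof (rule ccontr)
    assume *: "(lead_mon r f', t) \<notin> r"
    then have "lead_mon r f' \<in> Poly_Mapping.keys f" using f'(3) lead by (simp add: in_keys_iff)
    then show False using lead_mon_greatest(2)[OF carr[OF f(1)] ne[OF f(2)]] f(3) * by blast
  qed
  then have "lead_mon r f' = t" using \<open>(t, lead_mon r f') \<in> r\<close> term_order_antisym by blast
  then show False using lead f'(2) by (simp add: in_keys_iff)
qed

end
end
end

text \<open>Noetherian induction on a monomial ideal \<open>M\<close> contained in all the initial ideals: if one of them
  is larger, a reduced \<open>f \<in> J\<close> has finitely many candidates for its leading monomial, each
  outside \<open>M\<close>.\<close>

theorem finite_initial_ideals:
  fixes J :: "('k::field mpol) set"
  assumes J: "ideal J (polyring c A)" and A: "A \<subseteq> {1..}" "finite A"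
    and T: "\<And>r. r \<in> T \<Longrightarrow> term_order c r"
  shows "finite ((\<lambda>r. lead_mons r J) ` T)"
proof -
  \<comment> \<open>\<open>T\<close> is generalised together with \<open>M\<close>: the induction
    passes to the orders that select the same leading monomial \<open>k\<close> of \<open>f\<close>,
    whose initial ideals all contain \<open>M\<close> and the multiples of \<open>k\<close>.\<close>
  have "finite ((\<lambda>r. lead_mons r J) ` T)"
    if "M \<subseteq> monomials c A" "multiples c A M \<subseteq> M" "\<And>r. r \<in> T \<Longrightarrow> term_order c r \<and> M \<subseteq> lead_mons r J"
    for M T
    using wf_monomial_ideals[OF A(2), of c] that
  proof (induction M arbitrary: T rule: wf_induct_rule)
    case (less M)
    show ?case
    proof (cases "\<forall>r\<in>T. lead_mons r J = M")
      case True
      then have "(\<lambda>r. lead_mons r J) ` T \<subseteq> {M}" by blast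
      then show ?thesis by (rule finite_subset) simp
    next
      case False
      then obtain r m where r: "r \<in> T" "m \<in> lead_mons r J" "m \<notin> M" using less.prems(3) by blast
      have "term_order c r" "M \<subseteq> lead_mons r J" using less.prems(3)[OF r(1)] by auto
      then obtain f where f: "f \<in> J" "f \<noteq> 0" "Poly_Mapping.keys f \<inter> M = {}"
        using exists_reduced[OF _ A(1) J A(2) _ r(2,3)] by metis
      have fc: "f \<in> carrier (polyring c A)" using polyring_idealD(1)[OF J] f(1) by blast
      define S where "S = (\<lambda>k. {s\<in>T. lead_mon s f = k})"
      have "finite ((\<lambda>r. lead_mons r J) ` S k)" if k: "k \<in> Poly_Mapping.keys f" for k
      proof (rule less.IH)
        let ?M = "M \<union> multiples c A {k}"
        have kA: "k \<in> monomials c A" using fc k by (auto simp: polyring_def)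
        show sub: "?M \<subseteq> monomials c A"
          using less.prems(1) multiples_subset[of "{k}" c A] kA by simp
        have "k \<in> ?M" using multiples_superset[of "{k}"] by blast
        moreover have "k \<notin> M" using k f(3) by blast
        ultimately show "(?M, M) \<in> {(M', M). M \<subset> M' \<and> M' \<subseteq> monomials c A \<and> multiples c A M \<subseteq> M}"
          using sub less.prems(2) by blast
        have "multiples c A ?M = multiples c A M \<union> multiples c A (multiples c A {k})"
          by (rule multiples_Un)
        then show "multiples c A ?M \<subseteq> ?M" using less.prems(2) by (auto simp: multiples_multiples)
        fix s assume s: "s \<in> S k"
        then have order: "term_order c s" "M \<subseteq> lead_mons s J" using less.prems(3) by (auto simp: S_def)
        have "{k} \<subseteq> lead_mons s J" using s f by (auto simp: S_def lead_mons_def)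
        then have "multiples c A {k} \<subseteq> lead_mons s J"
          using multiples_mono lead_mons_multiples[OF order(1) A(1) J] by blast
        then show "term_order c s \<and> ?M \<subseteq> lead_mons s J" using order by blast
      qed
      then have "finite (\<Union>k\<in>Poly_Mapping.keys f. (\<lambda>r. lead_mons r J) ` S k)" by simp
      moreover have "(\<lambda>r. lead_mons r J) ` T \<subseteq> (\<Union>k\<in>Poly_Mapping.keys f. (\<lambda>r. lead_mons r J) ` S k)"
        using lead_mon_greatest(1)[OF _ A(1) fc f(2)] less.prems(3) by (auto simp: S_def)
      ultimately show ?thesis by (rule rev_finite_subset)
    qed
  qed
  from this[of "{}" T] T show ?thesis by (simp add: multiples_def)
qed

subsection \<open>Initial chains\<close>

lemma carrier_polyring_mono:
  "A \<subseteq> B \<Longrightarrow> carrier (polyring c A) \<subseteq> carrier (polyring c B)"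
  using monomials_mono[of A B c] by (auto simp: polyring_def)

lemma ideal_Int_polyring:
  fixes J :: "('k::field mpol) set"
  assumes J: "ideal J (polyring c A)" and "I \<subseteq> A"
  shows "ideal (J \<inter> carrier (polyring c I)) (polyring c I)"
proof (rule polyring_idealI)
  interpret R: cring "polyring c I :: ('k mpol) ring" by (rule cring_polyring)
  note IA = carrier_polyring_mono[OF assms(2), of c]
  show "0 \<in> J \<inter> carrier (polyring c I)"
    using polyring_idealD(2)[OF J] R.zero_closed by simp
  show "f + g \<in> J \<inter> carrier (polyring c I)"
    if "f \<in> J \<inter> carrier (polyring c I)" "g \<in> J \<inter> carrier (polyring c I)" for f g
    using that polyring_idealD(3)[OF J] R.a_closed[of f g] by simp
  show "h * f \<in> J \<inter> carrier (polyring c I)"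
    if "f \<in> J \<inter> carrier (polyring c I)" "h \<in> carrier (polyring c I)" for f h
    using that polyring_idealD(4)[OF J, of f h] R.m_closed[of h f] IA by auto
qed simp

text \<open>Increasing maps are injective, so the monomials of \<open>act p f\<close> are exactly
  the images of those of \<open>f\<close>; compatibility of the order keeps the largest one
  largest.\<close>

lemma lead_mon_act:
  assumes r: "Inc_compatible_order c r" and p: "p \<in> Inc"
    and f: "f \<in> carrier (polyring c A)" "A \<subseteq> {1..}" "f \<noteq> 0"
  shows "act p f \<noteq> 0" "lead_mon r (act p f) = act_mon p (lead_mon r f)"
proof -
  have order: "term_order c r" using r by (simp add: Inc_compatible_order_def)
  have keys: "Poly_Mapping.keys (act p f) = act_mon p ` Poly_Mapping.keys f"
    using keys_act[OF f(1)] inj_on_subset[OF IncD(1)[OF p] f(2)] by blast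
  then show "act p f \<noteq> 0" using f(3) by auto
  show "lead_mon r (act p f) = act_mon p (lead_mon r f)"
  proof (rule lead_mon_eqI[OF order])
    show "act_mon p (lead_mon r f) \<in> Poly_Mapping.keys (act p f)"
      using lead_mon_greatest(1)[OF order f(2,1,3)] keys by blast
    show "(m, act_mon p (lead_mon r f)) \<in> r" if "m \<in> Poly_Mapping.keys (act p f)" for m
      using that lead_mon_greatest(2)[OF order f(2,1,3)] keys r p
      by (auto simp: Inc_compatible_order_def)
  qed
qed

lemma act_setI: "p \<in> P \<Longrightarrow> f \<in> F \<Longrightarrow> act p f \<in> act_set P F"
  by (auto simp: act_set_def)

lemma lead_monsI: "f \<in> J \<Longrightarrow> f \<noteq> 0 \<Longrightarrow> lead_mon r f \<in> lead_mons r J"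
  by (auto simp: lead_mons_def)

text \<open>The monomials of the ideal that \<open>Ind\<close> compares with level \<open>n\<close>
  when level \<open>N\<close> of a chain is spanned by \<open>X\<close>.\<close>

definition orbit_mons :: "nat \<Rightarrow> nat \<Rightarrow> nat \<Rightarrow> mon set \<Rightarrow> mon set" where
  "orbit_mons c N n X = multiples c {1..n} {act_mon p m |p m. p \<in> Inc_mn N n \<and> m \<in> X}"

text \<open>The orbit contains images of arbitrary polynomials, but each of their terms is the image
  of a term supported on \<open>X\<close>; the sandwich form of
  \<open>genideal_monomial_ideal\<close> covers this.\<close>

lemma genideal_act_set:
  assumes "X \<subseteq> monomials c {1..N}"
  shows "Idl\<^bsub>polyring c {1..n}\<^esub> (act_set (Inc_mn N n) (monomial_ideal X :: ('k::field mpol) set)) =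
    monomial_ideal (orbit_mons c N n X)"
  unfolding orbit_mons_def
proof (rule genideal_monomial_ideal)
  let ?G = "{act_mon p m |p m. p \<in> Inc_mn N n \<and> m \<in> X}"
  have "act_mon p m \<in> monomials c {1..n}" if "p \<in> Inc_mn N n" "m \<in> X" for p m
    using act_mon_image[of m c "{1..N}" p] monomials_mono[OF Inc_mn_image[OF that(1)], of c] assms that(2)
    by (meson in_mono)
  then show "?G \<subseteq> monomials c {1..n}" by blast
  show "Poly_Mapping.single g 1 \<in> act_set (Inc_mn N n) (monomial_ideal X :: ('k mpol) set)"
    if "g \<in> ?G" for g
  proof -
    from that obtain p m where g: "g = act_mon p m" "p \<in> Inc_mn N n" "m \<in> X" by blast
    then have "act p (Poly_Mapping.single m (1 :: 'k)) \<in> act_set (Inc_mn N n) (monomial_ideal X)"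
      by (intro act_setI) simp_all
    then show ?thesis by (simp add: g(1))
  qed
  have "act p f \<in> monomial_ideal ?G" if "p \<in> Inc_mn N n" "f \<in> monomial_ideal X" for p and f :: "'k mpol"
    using that keys_act_subset[of p f] by (fastforce simp: monomial_ideal_def)
  moreover have "monomial_ideal ?G \<subseteq> (monomial_ideal (multiples c {1..n} ?G) :: ('k mpol) set)"
    using multiples_superset[of ?G c "{1..n}"] by (auto simp: monomial_ideal_def)
  ultimately show "act_set (Inc_mn N n) (monomial_ideal X) \<subseteq>
      (monomial_ideal (multiples c {1..n} ?G) :: ('k mpol) set)"
    by (auto simp: act_set_def)
qed

text \<open>On \<open>T\<close>, \<open>h\<close> factors through \<open>g\<close> by choosing a
  preimage of each value of \<open>g\<close>.\<close>

lemma finite_image_if_determined: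
  assumes "finite (g ` T)" "\<And>x y. x \<in> T \<Longrightarrow> y \<in> T \<Longrightarrow> g x = g y \<Longrightarrow> h x = h y"
  shows "finite (h ` T)"
proof -
  have "h x = h (inv_into T g (g x))" if "x \<in> T" for x
    using that by (intro assms(2)) (auto intro: inv_into_into simp: f_inv_into_f)
  then have "h ` T \<subseteq> (\<lambda>y. h (inv_into T g y)) ` (g ` T)" by auto
  then show ?thesis using assms(1) finite_surj by blast
qed

lemma positive_interval: "{1..n::nat} \<subseteq> {1..}"
  by auto

section \<open>The initial chains of a fixed invariant chain\<close>

context
  fixes c :: nat and J :: "nat \<Rightarrow> ('k::field mpol) set"
  assumes chain: "Inc_invariant_chain c J"
begin

lemma chain_ideal: "n \<ge> 1 \<Longrightarrow> ideal (J n) (polyring c {1..n})"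
  and chain_mono: "1 \<le> m \<Longrightarrow> m \<le> n \<Longrightarrow> J m \<subseteq> J n"
  using chain by (auto simp: Inc_invariant_chain_def ideal_chain_def)

lemma chain_act: "1 \<le> m \<Longrightarrow> m \<le> n \<Longrightarrow> p \<in> Inc_mn m n \<Longrightarrow> f \<in> J m \<Longrightarrow> act p f \<in> J n"
  using chain act_setI unfolding Inc_invariant_chain_def by blast

lemma chain_carrier: "n \<ge> 1 \<Longrightarrow> f \<in> J n \<Longrightarrow> f \<in> carrier (polyring c {1..n})"
  using polyring_idealD(1)[OF chain_ideal] by blast

context
  fixes r :: "mon rel"
  assumes compat: "Inc_compatible_order c r"
begin

lemma compat_term_order: "term_order c r"
  using compat by (simp add: Inc_compatible_order_def)

lemma chain_lead_mons:
  assumes "n \<ge> 1"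
  shows "lead_mons r (J n) \<subseteq> monomials c {1..n}"
    and "multiples c {1..n} (lead_mons r (J n)) \<subseteq> lead_mons r (J n)"
    and "init_ideal c r {1..n} (J n) = monomial_ideal (lead_mons r (J n))"
  using lead_mons_monomials[OF compat_term_order positive_interval chain_ideal[OF assms]]
    lead_mons_multiples[OF compat_term_order positive_interval chain_ideal[OF assms]]
    init_ideal_eq[OF compat_term_order positive_interval chain_ideal[OF assms]]
  by blast+

text \<open>This makes the initial chain invariant again: increasing maps commute with taking
  leading monomials.\<close>

lemma chain_lead_mons_act:
  assumes "1 \<le> m" "m \<le> n" "p \<in> Inc_mn m n"
  shows "act_mon p ` lead_mons r (J m) \<subseteq> lead_mons r (J n)"
proof (intro image_subsetI)
  fix w assume "w \<in> lead_mons r (J m)"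
  then obtain f where f: "f \<in> J m" "f \<noteq> 0" "w = lead_mon r f" by (auto simp: lead_mons_def)
  have "p \<in> Inc" using assms(3) by (simp add: Inc_mn_def)
  note lead = lead_mon_act[OF compat this chain_carrier[OF assms(1) f(1)] positive_interval f(2)]
  show "act_mon p w \<in> lead_mons r (J n)"
    using lead_monsI[OF chain_act[OF assms f(1)] lead(1), of r] lead(2) f(3) by simp
qed

lemma orbit_mons_subset:
  assumes "1 \<le> N" "N \<le> n"
  shows "orbit_mons c N n (lead_mons r (J N)) \<subseteq> lead_mons r (J n)"
proof -
  have "{act_mon p m |p m. p \<in> Inc_mn N n \<and> m \<in> lead_mons r (J N)} \<subseteq> lead_mons r (J n)"
    using chain_lead_mons_act[OF assms] by blast
  then show ?thesis
    unfolding orbit_mons_def using multiples_mono chain_lead_mons(2)[of n] assms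
    by (meson le_trans order_trans)
qed

definition stable_at :: "nat \<Rightarrow> bool" where
  "stable_at N \<longleftrightarrow> N \<ge> 1 \<and> (\<forall>n\<ge>N. orbit_mons c N n (lead_mons r (J N)) = lead_mons r (J n))"

text \<open>Both ideals compared by \<open>Ind\<close> are spanned by monomials, so their equality
  is an equality of monomial sets. Only indices from 1 on are compared, where the restriction in
  \<open>init_chain\<close> has no effect.\<close>

lemma Ind_init_chain: "Ind c (init_chain c r J) = (LEAST N. stable_at N)"
proof -
  have eq: "(Idl\<^bsub>polyring c {1..n}\<^esub> (act_set (Inc_mn N n) (init_chain c r J N)) = init_chain c r J n) \<longleftrightarrow>
      orbit_mons c N n (lead_mons r (J N)) = lead_mons r (J n)" if "1 \<le> N" "N \<le> n" for N n
    using that chain_lead_mons(3)[of N] chain_lead_mons(3)[of n]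
      genideal_act_set[OF chain_lead_mons(1)[of N], where 'k = 'k]
    by (simp add: init_chain_def)
  have "(N \<ge> 1 \<and> (\<forall>n\<ge>N. Idl\<^bsub>polyring c {1..n}\<^esub>
      (act_set (Inc_mn N n) (init_chain c r J N)) = init_chain c r J n)) = stable_at N" for N
    unfolding stable_at_def using eq[of N] by blast
  then show ?thesis unfolding Ind_def by simp
qed

text \<open>Stabilisation of monomial chains guarantees that the minimum defining the index is
  attained, so \<open>Ind\<close> is not an arbitrary default value.\<close>

lemma stable_at_Ind: "stable_at (Ind c (init_chain c r J))"
proof -
  have "\<exists>N. stable_at N"
    unfolding stable_at_def orbit_mons_def
    using monomial_chain_stabilizes[of "\<lambda>n. lead_mons r (J n)" c,
        OF chain_lead_mons(1,2) chain_lead_mons_act] by blast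
  then show ?thesis unfolding Ind_init_chain by (rule LeastI_ex)
qed

lemma Ind_le_if_stable_at: "stable_at N \<Longrightarrow> Ind c (init_chain c r J) \<le> N"
  unfolding Ind_init_chain by (rule Least_le)

text \<open>A sum of monomial ideals is spanned by the union of their monomials. One inclusion is
  automatic since \<open>J n \<inter> carrier (polyring c I)\<close> is contained in
  \<open>J n\<close>.\<close>

lemma init_ideal_sum_eq_iff:
  assumes "n \<ge> 1"
  shows "init_ideal c r {1..n} (J n) =
      (\<Sum>I | I \<subseteq> {1..n} \<and> card I = N.
         Idl\<^bsub>polyring c {1..n}\<^esub> (init_ideal c r I (J n \<inter> carrier (polyring c I)))) \<longleftrightarrow>
    lead_mons r (J n) \<subseteq>
      (\<Union>I\<in>{I. I \<subseteq> {1..n} \<and> card I = N}.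
         multiples c {1..n} (lead_mons r (J n \<inter> carrier (polyring c I))))"
    (is "_ = (\<Sum>I | ?P I. ?S I) \<longleftrightarrow> _ \<subseteq> (\<Union>I\<in>_. multiples c _ (?L I))")
proof -
  have "?S I = monomial_ideal (multiples c {1..n} (?L I))" if "?P I" for I
  proof -
    have I: "I \<subseteq> {1..n}" "I \<subseteq> {1..}" using that by auto
    note ideal = ideal_Int_polyring[OF chain_ideal[OF assms] I(1)]
    show ?thesis
      unfolding init_ideal_eq[OF compat_term_order I(2) ideal]
    proof (rule genideal_monomial_ideal)
      show "?L I \<subseteq> monomials c {1..n}"
        using lead_mons_monomials[OF compat_term_order I(2) ideal] monomials_mono[OF I(1)] by blast
      show "monomial_ideal (?L I) \<subseteq> monomial_ideal (multiples c {1..n} (?L I))"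
        using multiples_superset[of "?L I" c "{1..n}"] unfolding monomial_ideal_def by blast
    qed simp
  qed
  then have "(\<Sum>I | ?P I. ?S I) = (\<Sum>I | ?P I. monomial_ideal (multiples c {1..n} (?L I)))"
    by (intro sum.cong) auto
  also have "\<dots> = monomial_ideal (\<Union>I\<in>{I. ?P I}. multiples c {1..n} (?L I))"
    by (rule monomial_ideal_sum) simp
  finally have sum: "(\<Sum>I | ?P I. ?S I) = monomial_ideal (\<Union>I\<in>{I. ?P I}. multiples c {1..n} (?L I))" .
  have "?L I \<subseteq> lead_mons r (J n)" for I by (auto simp: lead_mons_def)
  then have "multiples c {1..n} (?L I) \<subseteq> lead_mons r (J n)" for I
    using multiples_mono chain_lead_mons(2)[OF assms] by (meson order_trans)
  then have "(\<Union>I\<in>{I. ?P I}. multiples c {1..n} (?L I)) \<subseteq> lead_mons r (J n)" by blast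
  then show ?thesis unfolding sum chain_lead_mons(3)[OF assms] monomial_ideal_eq_iff by blast
qed

end

section \<open>Bounded stability indices, finitely many initial chains, and locality\<close>

text \<open>For \<open>r\<close>, level \<open>n\<close> is generated from level \<open>N\<close>,
  where \<open>s\<close> has the same leading monomials; what these generate stays inside level
  \<open>n\<close> for \<open>s\<close>.\<close>

lemma lead_mons_eq_from_stable:
  assumes r: "Inc_compatible_order c r" and s: "Inc_compatible_order c s"
    and stable: "stable_at r N" "N \<le> B"
    and eq: "\<And>k. k \<in> {1..B} \<Longrightarrow> lead_mons r (J k) = lead_mons s (J k)"
    and n: "n > B"
  shows "lead_mons r (J n) \<subseteq> lead_mons s (J n)"
proof -
  have N: "N \<ge> 1" and "lead_mons r (J n) = orbit_mons c N n (lead_mons r (J N))"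
    using stable n by (auto simp: stable_at_def[OF r])
  moreover have "lead_mons r (J N) = lead_mons s (J N)" using eq N stable(2) by simp
  ultimately show ?thesis using orbit_mons_subset[OF s N, of n] stable(2) n by simp
qed

lemma finite_init_chains_if_Ind_bounded:
  assumes "bdd_above {Ind c (init_chain c r J) |r. Inc_compatible_order c r}"
  shows "finite {init_chain c r J |r. Inc_compatible_order c r}"
proof -
  obtain B where B: "\<And>r. Inc_compatible_order c r \<Longrightarrow> Ind c (init_chain c r J) \<le> B"
    using assms by (auto simp: bdd_above_def)
  let ?T = "{r. Inc_compatible_order c r}"
  \<comment> \<open>The first \<open>B\<close> levels of the initial chain, each with finitely many
    possibilities.\<close>
  let ?g = "\<lambda>r. \<lambda>n\<in>{1..B}. lead_mons r (J n)"
  have fin: "finite ((\<lambda>r. lead_mons r (J n)) ` ?T)" if "n \<in> {1..B}" for n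
  proof -
    have "ideal (J n) (polyring c {1..n})" using that by (intro chain_ideal) simp
    then show ?thesis
      by (rule finite_initial_ideals) (auto simp: Inc_compatible_order_def)
  qed
  have "?g ` ?T \<subseteq> (\<Pi>\<^sub>E n\<in>{1..B}. (\<lambda>r. lead_mons r (J n)) ` ?T)" by auto
  moreover have "finite (\<Pi>\<^sub>E n\<in>{1..B}. (\<lambda>r. lead_mons r (J n)) ` ?T)"
    by (rule finite_PiE[OF finite_atLeastAtMost fin])
  ultimately have "finite (?g ` ?T)" by (rule finite_subset)
  then have "finite ((\<lambda>r. init_chain c r J) ` ?T)"
  proof (rule finite_image_if_determined)
    fix r s assume rs: "r \<in> ?T" "s \<in> ?T" "?g r = ?g s"
    then have r: "Inc_compatible_order c r" and s: "Inc_compatible_order c s" by auto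
    have eq: "lead_mons r (J n) = lead_mons s (J n)" if "n \<in> {1..B}" for n
      using fun_cong[OF rs(3), of n] that by simp
    have "lead_mons r (J n) = lead_mons s (J n)" if "n \<ge> 1" for n
    proof (cases "n \<le> B")
      case False
      then have n: "n > B" by simp
      \<comment> \<open>Equality takes two inclusions, since \<open>r\<close> and \<open>s\<close>
        may have different stability indices below \<open>B\<close>.\<close>
      show ?thesis
        using lead_mons_eq_from_stable[OF r s stable_at_Ind[OF r] B[OF r] eq n]
          lead_mons_eq_from_stable[OF s r stable_at_Ind[OF s] B[OF s] eq[symmetric] n] by blast
    qed (use eq that in simp)
    then have "init_ideal c r {1..n} (J n) = init_ideal c s {1..n} (J n)" if "n \<ge> 1" for n
      using chain_lead_mons(3)[OF r that] chain_lead_mons(3)[OF s that] that by simp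
    then show "init_chain c r J = init_chain c s J"
      unfolding init_chain_def by (intro restrict_ext) simp
  qed
  then show ?thesis by (simp add: image_Collect)
qed

text \<open>The index depends on the order only through the initial chain, so finitely many chains
  have finitely many indices.\<close>

lemma Ind_bounded_if_finite_init_chains:
  assumes "finite {init_chain c r J |r. Inc_compatible_order c r}"
  shows "bdd_above {Ind c (init_chain c r J) |r. Inc_compatible_order c r}"
proof -
  have "{Ind c (init_chain c r J) |r. Inc_compatible_order c r} =
      Ind c ` {init_chain c r J |r. Inc_compatible_order c r}" by blast
  then show ?thesis using assms by (simp add: bdd_above_finite)
qed

lemma init_local_if_Ind_bounded:
  assumes "bdd_above {Ind c (init_chain c r J) |r. Inc_compatible_order c r}"
  shows "init_local c J"
proof -
  obtain B where B: "\<And>r. Inc_compatible_order c r \<Longrightarrow> Ind c (init_chain c r J) \<le> B"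
    using assms by (auto simp: bdd_above_def)
  \<comment> \<open>\<open>init_local\<close> asks for a positive number, while \<open>B\<close>
    might be 0.\<close>
  define N where "N = max 1 B"
  have "w \<in> (\<Union>I\<in>{I. I \<subseteq> {1..n} \<and> card I = N}.
      multiples c {1..n} (lead_mons r (J n \<inter> carrier (polyring c I))))"
    if r: "Inc_compatible_order c r" and n: "n \<ge> N" and w: "w \<in> lead_mons r (J n)" for r n w
  proof -
    define M where "M = Ind c (init_chain c r J)"
    have M: "1 \<le> M" "M \<le> N" "orbit_mons c M n (lead_mons r (J M)) = lead_mons r (J n)"
      using stable_at_Ind[OF r] B[OF r] n unfolding stable_at_def[OF r] M_def N_def by auto
    obtain p f h where p: "p \<in> Inc_mn M n" and f: "f \<in> J M" "f \<noteq> 0"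
      and h: "h \<in> monomials c {1..n}" and w_eq: "w = act_mon p (lead_mon r f) + h"
      using w[folded M(3)] unfolding orbit_mons_def multiples_def lead_mons_def by blast
    have pI: "p \<in> Inc" using p by (simp add: Inc_mn_def)
    have "card (p ` {1..M}) = M"
      using inj_on_subset[OF IncD(1)[OF pI] positive_interval[of M]] by (simp add: card_image)
    \<comment> \<open>\<open>act p f\<close> lives in the \<open>M\<close> columns \<open>p\<close>
      takes \<open>{1..M}\<close> to; as \<open>M \<le> N \<le> n\<close>, they can be padded to
      exactly \<open>N\<close> columns of \<open>{1..n}\<close>.\<close>
    then obtain I where I: "p ` {1..M} \<subseteq> I" "I \<subseteq> {1..n}" "card I = N"
      using exists_subset_between[of "p ` {1..M}" N "{1..n}"] Inc_mn_image[OF p] M(2) n by auto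
    have fc: "f \<in> carrier (polyring c {1..M})" using chain_carrier[OF M(1) f(1)] .
    have "act p f \<in> J n" using chain_act[OF M(1) _ p f(1)] M(2) n by simp
    moreover have "act p f \<in> carrier (polyring c I)"
      using act_carrier[OF fc, of p] carrier_polyring_mono[OF I(1)] by blast
    ultimately have "act_mon p (lead_mon r f) \<in> lead_mons r (J n \<inter> carrier (polyring c I))"
      using lead_mon_act[OF r pI fc positive_interval f(2)]
        lead_monsI[of "act p f" "J n \<inter> carrier (polyring c I)" r] by simp
    then have "w \<in> multiples c {1..n} (lead_mons r (J n \<inter> carrier (polyring c I)))"
      unfolding w_eq using h by (rule multiplesI)
    then show ?thesis using I(2,3) by blast
  qed
  moreover have "N \<ge> 1" by (simp add: N_def)
  ultimately show ?thesis
    unfolding init_local_def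
    by (intro exI[of _ N] conjI allI impI) (auto simp: init_ideal_sum_eq_iff simp del: One_nat_def)
qed

section \<open>From locality back to bounded indices in the symmetric case\<close>

text \<open>The ascending chain condition in \<open>polyring c {1..N}\<close>, inherited from
  monomials: beyond a level with maximal leading monomials, nested ideals have equal leading
  monomials and hence coincide. The order \<open>r\<close> is only a tool, and the conclusion does
  not mention it.\<close>

lemma chain_Int_polyring_stabilizes:
  assumes r: "term_order c r" and "N \<ge> 1"
  shows "\<exists>M\<ge>N. \<forall>n\<ge>M. J n \<inter> carrier (polyring c {1..N}) \<subseteq> J M"
proof -
  let ?K = "\<lambda>n. J n \<inter> carrier (polyring c {1..N})"
  let ?s = "{(M', M). M \<subset> M' \<and> M' \<subseteq> monomials c {1..N} \<and> multiples c {1..N} M \<subseteq> M}"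
  have ideal: "ideal (?K n) (polyring c {1..N})" if "n \<ge> N" for n
    using that assms(2) by (intro ideal_Int_polyring[OF chain_ideal[of n]]) auto
  have "wf ?s" by (rule wf_monomial_ideals) simp
  moreover define Q where "Q = (\<lambda>n. lead_mons r (?K n)) ` {N..}"
  moreover have "lead_mons r (?K N) \<in> Q" by (simp add: Q_def)
  ultimately have "\<exists>Y\<in>Q. \<forall>Z. (Z, Y) \<in> ?s \<longrightarrow> Z \<notin> Q"
    by (simp only: wf_eq_minimal)
  then obtain Y where Y: "Y \<in> Q" "\<forall>Z. (Z, Y) \<in> ?s \<longrightarrow> Z \<notin> Q" ..
  from Y(1) obtain M where M: "M \<ge> N" "Y = lead_mons r (?K M)" by (auto simp: Q_def)
  have "?K n = ?K M" if "n \<ge> M" for n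
  proof -
    have sub: "?K M \<subseteq> ?K n" using chain_mono[of M n] that M(1) assms(2) by auto
    then have "lead_mons r (?K M) \<subseteq> lead_mons r (?K n)" by (auto simp: lead_mons_def)
    moreover have "\<not> lead_mons r (?K M) \<subset> lead_mons r (?K n)"
    proof
      assume "lead_mons r (?K M) \<subset> lead_mons r (?K n)"
      moreover have "lead_mons r (?K n) \<subseteq> monomials c {1..N}"
        using lead_mons_monomials[OF r positive_interval ideal[of n]] that M(1) by simp
      ultimately have "(lead_mons r (?K n), Y) \<in> ?s"
        using lead_mons_multiples[OF r positive_interval ideal[OF M(1)]] by (simp add: M(2))
      moreover have "lead_mons r (?K n) \<in> Q" using that M(1) by (simp add: Q_def)
      ultimately show False using Y(2) by blast
    qed
    ultimately have "lead_mons r (?K M) = lead_mons r (?K n)" by blast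
    moreover have "n \<ge> N" using that M(1) by simp
    ultimately show ?thesis
      using ideal_eq_if_lead_mons_eq[OF r positive_interval ideal[of n] _ ideal[OF M(1)] sub] by simp
  qed
  then show ?thesis using M(1) by blast
qed

text \<open>A polynomial of \<open>J\<^sub>n\<close> in \<open>N\<close> column variables \<open>I\<close> is moved by a permutation into
  \<open>R\<^sub>N\<close>, where the chain is stationary from \<open>M\<close> on, and then by a permutation of \<open>[M]\<close> and an
  increasing map back to \<open>I\<close>.\<close>

lemma Sym_chain_decompose:
  assumes sym: "Sym_invariant_chain c J" and M: "1 \<le> N" "N \<le> M" "M \<le> n"
    and stat: "J n \<inter> carrier (polyring c {1..N}) \<subseteq> J M"
    and I: "I \<subseteq> {1..n}" "card I = N" and f: "f \<in> J n" "f \<in> carrier (polyring c I)"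
  shows "\<exists>q\<in>Inc_mn M n. \<exists>g\<in>J M. f = act q g"
proof -
  have sym_act: "act \<sigma> h \<in> J k" if "\<sigma> permutes {1..k}" "h \<in> J k" "k \<ge> 1" for \<sigma> h k
    using that sym act_setI[of \<sigma> "{\<sigma>. \<sigma> permutes {1..k}}" h "J k"]
    unfolding Sym_invariant_chain_def by blast
  \<comment> \<open>The columns \<open>I\<close> are padded to \<open>M\<close> columns so that the
    enumeration \<open>q\<close> of \<open>I'\<close> starts from \<open>{1..M}\<close>.\<close>
  obtain I' where I': "I \<subseteq> I'" "I' \<subseteq> {1..n}" "card I' = M"
    using exists_subset_between[of I M "{1..n}"] I M by auto
  then obtain q where q: "q \<in> Inc_mn M n" "q ` {1..M} = I'"
    using Inc_enumerating[of I' n M] M by auto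
  have finI: "finite I" using I(1) finite_subset by blast
  then obtain e where e: "bij_betw e I {1..N}"
    using finite_same_card_bij[of I "{1..N}"] I(2) by auto
  obtain \<rho> where \<rho>: "\<rho> permutes {1..n}" "\<And>i. i \<in> I \<Longrightarrow> \<rho> i = e i"
    using permutes_extending_inj_on[of "{1..n}" I e] I(1) e M by (auto simp: bij_betw_def)
  \<comment> \<open>\<open>k\<close> takes an element of \<open>{1..N}\<close> back to its column in
    \<open>I\<close> and then to the position of that column in the enumeration \<open>q\<close>.
    Its extension \<open>\<tau>\<close> and the extension \<open>\<rho>\<close> of \<open>e\<close>
    are permutations under which the chain is invariant.\<close>
  define k where "k = inv_into {1..M} q \<circ> inv_into I e"
  have inv_e: "bij_betw (inv_into I e) {1..N} I" using e by (rule bij_betw_inv_into)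
  have "inj_on k {1..N}"
    unfolding k_def
  proof (rule comp_inj_on)
    show "inj_on (inv_into I e) {1..N}" using inv_e by (simp add: bij_betw_def)
    have "inv_into I e ` {1..N} \<subseteq> q ` {1..M}" using inv_e I'(1) q(2) by (simp add: bij_betw_def)
    then show "inj_on (inv_into {1..M} q) (inv_into I e ` {1..N})" by (rule inj_on_inv_into)
  qed
  moreover have "k ` {1..N} \<subseteq> {1..M}"
  proof (intro image_subsetI)
    fix x assume "x \<in> {1..N}"
    then have "inv_into I e x \<in> q ` {1..M}"
      using bij_betwE[OF inv_e] I'(1) q(2) by blast
    then show "k x \<in> {1..M}" unfolding k_def comp_def by (rule inv_into_into)
  qed
  ultimately obtain \<tau> where \<tau>: "\<tau> permutes {1..M}" "\<And>x. x \<in> {1..N} \<Longrightarrow> \<tau> x = k x"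
    using permutes_extending_inj_on[of "{1..M}" "{1..N}" k] M by auto
  \<comment> \<open>The three maps compose to the identity on \<open>I\<close>, so they fix
    \<open>f\<close>; the required preimage of \<open>f\<close> under \<open>q\<close> is
    \<open>act \<tau> (act \<rho> f)\<close>.\<close>
  have q_inverse: "(q \<circ> (\<tau> \<circ> \<rho>)) i = id i" if "i \<in> I" for i
  proof -
    have "e i \<in> {1..N}" using e that by (auto simp: bij_betw_def)
    then have "\<tau> (\<rho> i) = inv_into {1..M} q i"
      using that \<rho>(2) \<tau>(2) e by (simp add: k_def bij_betw_inv_into_left)
    moreover have "i \<in> q ` {1..M}" using that I'(1) q(2) by blast
    ultimately show ?thesis by (simp add: f_inv_into_f)
  qed
  have "\<rho> ` I = {1..N}" using \<rho>(2) e by (auto simp: bij_betw_def)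
  then have "act \<rho> f \<in> J n \<inter> carrier (polyring c {1..N})"
    using act_carrier[OF f(2), of \<rho>] sym_act[OF \<rho>(1) f(1)] M by simp
  then have "act \<tau> (act \<rho> f) \<in> J M" using stat sym_act[OF \<tau>(1)] M by auto
  moreover have "act (q \<circ> (\<tau> \<circ> \<rho>)) f = act id f"
    by (rule act_cong[OF f(2) q_inverse])
  then have "act q (act \<tau> (act \<rho> f)) = f"
    by (simp add: act_comp act_id)
  ultimately show ?thesis using q(1) by metis
qed

lemma Ind_bounded_if_init_local:
  assumes sym: "Sym_invariant_chain c J" and loc: "init_local c J"
  shows "bdd_above {Ind c (init_chain c r J) |r. Inc_compatible_order c r}"
proof (cases "\<exists>r. Inc_compatible_order c r")
  \<comment> \<open>Some term order is needed to obtain \<open>M\<close>; if no compatible one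
    exists, the set of indices is empty and thus bounded.\<close>
  case True
  then obtain r0 where "term_order c r0" by (auto simp: Inc_compatible_order_def)
  obtain N where N: "N \<ge> 1" and "\<And>n r. n \<ge> N \<Longrightarrow> Inc_compatible_order c r \<Longrightarrow>
    init_ideal c r {1..n} (J n) = (\<Sum>I | I \<subseteq> {1..n} \<and> card I = N.
      Idl\<^bsub>polyring c {1..n}\<^esub> (init_ideal c r I (J n \<inter> carrier (polyring c I))))"
    using loc unfolding init_local_def by blast
  then have loc: "lead_mons r (J n) \<subseteq> (\<Union>I\<in>{I. I \<subseteq> {1..n} \<and> card I = N}.
      multiples c {1..n} (lead_mons r (J n \<inter> carrier (polyring c I))))"
    if "n \<ge> N" "Inc_compatible_order c r" for n r
    using that init_ideal_sum_eq_iff[of r n N] by simp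
  obtain M where M: "M \<ge> N" "\<And>n. n \<ge> M \<Longrightarrow> J n \<inter> carrier (polyring c {1..N}) \<subseteq> J M"
    using chain_Int_polyring_stabilizes[OF \<open>term_order c r0\<close> N] by blast
  have M1: "M \<ge> 1" using M(1) N by simp
  \<comment> \<open>\<open>M\<close> was fixed before \<open>r\<close>, so it bounds the indices of
    all compatible orders at once.\<close>
  have "Ind c (init_chain c r J) \<le> M" if r: "Inc_compatible_order c r" for r
  proof (rule Ind_le_if_stable_at[OF r])
    have "lead_mons r (J n) \<subseteq> orbit_mons c M n (lead_mons r (J M))" if n: "n \<ge> M" for n
    proof
      fix w assume "w \<in> lead_mons r (J n)"
      then obtain I where I: "I \<subseteq> {1..n}" "card I = N"
        and "w \<in> multiples c {1..n} (lead_mons r (J n \<inter> carrier (polyring c I)))"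
        using loc[OF le_trans[OF M(1) n] r] by blast
      then obtain f h where f: "f \<in> J n" "f \<in> carrier (polyring c I)" "f \<noteq> 0"
        and h: "h \<in> monomials c {1..n}" and w: "w = lead_mon r f + h"
        unfolding multiples_def lead_mons_def by blast
      obtain q g where q: "q \<in> Inc_mn M n" and g: "g \<in> J M" "f = act q g"
        using Sym_chain_decompose[OF sym N M(1) n M(2)[OF n] I f(1,2)] by blast
      have "g \<noteq> 0" using f(3) g(2) by auto
      moreover have "q \<in> Inc" using q by (simp add: Inc_mn_def)
      ultimately have "lead_mon r f = act_mon q (lead_mon r g)"
        using lead_mon_act(2)[OF r _ chain_carrier[OF M1 g(1)] positive_interval] g(2) by simp
      moreover have "lead_mon r g \<in> lead_mons r (J M)"
        using g(1) \<open>g \<noteq> 0\<close> by (auto simp: lead_mons_def)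
      ultimately show "w \<in> orbit_mons c M n (lead_mons r (J M))"
        unfolding orbit_mons_def w using q h by (intro multiplesI) auto
    qed
    then show "stable_at r M"
      unfolding stable_at_def[OF r] using M1 orbit_mons_subset[OF r M1] by blast
  qed
  then show ?thesis unfolding bdd_above_def by blast
qed simp

end

theorem theorem3p15:
  fixes c :: nat and J :: "nat \<Rightarrow> ('k::field mpol) set"
  assumes "c \<ge> 1" and "Inc_invariant_chain c J"
  shows "(bdd_above {Ind c (init_chain c r J) |r. Inc_compatible_order c r}
            \<longleftrightarrow> finite {init_chain c r J |r. Inc_compatible_order c r})
       \<and> (bdd_above {Ind c (init_chain c r J) |r. Inc_compatible_order c r}
            \<longrightarrow> init_local c J)
       \<and> (Sym_invariant_chain c J \<longrightarrow>
            (init_local c J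
              \<longleftrightarrow> bdd_above {Ind c (init_chain c r J) |r. Inc_compatible_order c r}))"
  by (intro conjI impI iffI)
     (rule finite_init_chains_if_Ind_bounded[OF assms(2)] Ind_bounded_if_finite_init_chains[OF assms(2)]
        init_local_if_Ind_bounded[OF assms(2)] Ind_bounded_if_init_local[OF assms(2)]; assumption)+

end
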